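(* Let $\alpha>-1$, $\gamma>-1$, $\delta>0$, $a>0$ and $u>0$. Then $$G^{2,1}_{1,2}\left[au\,\Big|\,{-1-\gamma\atop \alpha,\ \delta-1}\right]=\Gamma(\gamma+1+\delta)\,a^{\alpha}u^{\delta-1}\int_0^{\infty}v^{\alpha+\gamma+1}(u+v)^{-(\gamma+1+\delta)}e^{-av}\,dv$$ $$=\Gamma(\gamma+1+\delta)\,a^{\alpha}u^{\alpha}\int_0^{\infty}v^{\alpha+\gamma+1}(1+v)^{-(\gamma+1+\delta)}e^{-auv}\,dv .$$ If moreover $\delta-1-\alpha\ne\pm\nu$ for all $\nu=0,1,\dots$, then these also equal $$\Gamma(\delta-1-\alpha)\Gamma(2+\gamma+\alpha)(au)^{\alpha}\,{}_1F_1(2+\gamma+\alpha;2+\alpha-\delta;au)+\Gamma(1+\gamma+\delta)\Gamma(1+\alpha-\delta)(au)^{\delta-1}\,{}_1F_1(1+\gamma+\delta;\delta-\alpha;au).$$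
   Context: Meijer G-function: for $z>0$, $$G^{m,n}_{p,q}\left[z\,\Big|\,{a_1,\dots,a_p\atop b_1,\dots,b_q}\right]=\frac1{2\pi i}\int_{\kappa-i\infty}^{\kappa+i\infty}\frac{\prod_{j=1}^m\Gamma(b_j+s)\prod_{j=1}^n\Gamma(1-a_j-s)}{\prod_{j=m+1}^q\Gamma(1-b_j-s)\prod_{j=n+1}^p\Gamma(a_j+s)}\,z^{-s}\,ds,$$ where the real number $\kappa$ is such that all poles of $\Gamma(b_j+s)$, $j\le m$, lie to the left and all poles of $\Gamma(1-a_j-s)$, $j\le n$, lie to the right of the line $\Re s=\kappa$ (such $\kappa$ exists under the stated hypotheses). In the present case the integrand is $\Gamma(\alpha+s)\Gamma(\delta-1+s)\Gamma(2+\gamma-s)(au)^{-s}$. ${}_1F_1$ is the confluent hypergeometric series. *)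

theory Defs
  imports "HOL-Complex_Analysis.Complex_Analysis"
begin

text \<open>
  The orders \<open>p\<close> and \<open>q\<close> of the Meijer function are the lengths of the parameter lists
  \<open>as\<close> and \<open>bs\<close>. List positions start at 0, so the mathematical \<open>b\<^sub>j\<close> is \<open>bs ! (j - 1)\<close>; the
  definitions are meant for \<open>m \<le> length bs\<close> and \<open>n \<le> length as\<close>.

  Since \<^const>\<open>Gamma\<close> vanishes at its poles and \<open>x / 0 = 0\<close>, a pole of a Gamma factor in the
  denominator makes the quotient 0, as it should.
\<close>

definition meijer_G_integrand ::
  "nat \<Rightarrow> nat \<Rightarrow> complex list \<Rightarrow> complex list \<Rightarrow> real \<Rightarrow> complex \<Rightarrow> complex" where
  "meijer_G_integrand m n as bs z s =
     ((\<Prod>j<m. Gamma (bs ! j + s)) * (\<Prod>j<n. Gamma (1 - as ! j - s))) /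
     ((\<Prod>j=m..<length bs. Gamma (1 - bs ! j - s)) * (\<Prod>j=n..<length as. Gamma (as ! j + s)))
     * of_real z powr (- s)"

definition meijer_G_separating ::
  "nat \<Rightarrow> nat \<Rightarrow> complex list \<Rightarrow> complex list \<Rightarrow> real \<Rightarrow> bool" where
  "meijer_G_separating m n as bs \<kappa> \<longleftrightarrow>
     (\<forall>j<m. \<forall>w. is_pole (\<lambda>s. Gamma (bs ! j + s)) w \<longrightarrow> Re w < \<kappa>) \<and>
     (\<forall>j<n. \<forall>w. is_pole (\<lambda>s. Gamma (1 - as ! j - s)) w \<longrightarrow> \<kappa> < Re w)"

text \<open>
  The line \<open>Re s = \<kappa>\<close> is parametrised by \<open>s = \<kappa> + \<i>t\<close>, \<open>ds = \<i> dt\<close>. The Henstock--Kurzweil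
  integral over the real line also covers conditionally convergent improper integrals.
\<close>

definition meijer_G_line ::
  "nat \<Rightarrow> nat \<Rightarrow> complex list \<Rightarrow> complex list \<Rightarrow> real \<Rightarrow> real \<Rightarrow> complex" where
  "meijer_G_line m n as bs z \<kappa> =
     1 / (2 * of_real pi * \<i>) *
     integral UNIV (\<lambda>t::real. meijer_G_integrand m n as bs z (Complex \<kappa> t) * \<i>)"

text \<open>
  The choice of the separating abscissa is immaterial whenever the function is well defined;
  statements about \<open>meijer_G\<close> should record existence and independence of that choice.
\<close>

definition meijer_G ::
  "nat \<Rightarrow> nat \<Rightarrow> complex list \<Rightarrow> complex list \<Rightarrow> real \<Rightarrow> complex" where
  "meijer_G m n as bs z =
     meijer_G_line m n as bs z (SOME \<kappa>. meijer_G_separating m n as bs \<kappa>)"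

definition hyp1F1 :: "real \<Rightarrow> real \<Rightarrow> real \<Rightarrow> real" where
  "hyp1F1 a b x = eval_fps (fps_hypergeo [a] [b] 1) x"

lemma hyp1F1_series:
  "hyp1F1 a b x = (\<Sum>k. pochhammer a k / (pochhammer b k * fact k) * x ^ k)"
  by (simp add: hyp1F1_def eval_fps_def)

end

theory Submission
  imports Defs "HOL-Probability.Sinc_Integral" "HOL-Real_Asymp.Real_Asymp"
begin

text \<open>
  Put \<open>x = a u\<close>. The integrand \<open>\<Gamma>(\<alpha> + s) \<Gamma>(\<delta> - 1 + s) \<Gamma>(2 + \<gamma> - s) x\<^sup>-\<^sup>s\<close> decays faster than any power of
  \<open>Im s\<close> in vertical strips, simply because the recurrence for \<open>\<Gamma>\<close> trades each unit shift for a factor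
  \<open>1/s\<close> (lemma \<open>Gamma_vertical_decay\<close>). Hence all line integrals converge absolutely and vertical lines may be
  moved by the residue theorem (\<open>vertical_line_shift\<close>). Moving a line to \<open>-\<infinity>\<close> in unit steps is
  harmless as soon as each step multiplies the integrand by a factor that tends uniformly to 0;
  the integral is then the sum of the residues (\<open>line_integral_eq_residue_series\<close>).

  This principle is used twice. For \<open>\<Gamma>(s) y\<^sup>-\<^sup>s\<close> the residues add up to \<open>e\<^sup>-\<^sup>y\<close>, which is the
  Cahen--Mellin formula (\<open>Cahen_Mellin\<close>). For the full integrand the two families of poles to the left,
  \<open>-\<alpha> - k\<close> and \<open>1 - \<delta> - k\<close>, are simple when \<open>\<delta> - 1 - \<alpha>\<close> is not an integer, and they produce the two
  confluent series (\<open>mellin_barnes_residue_series\<close>).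

  For the integral representation, \<open>\<Gamma>(\<delta> - 1 + s) \<Gamma>(2 + \<gamma> - s)\<close> is \<open>\<Gamma>(\<gamma> + 1 + \<delta>)\<close> times the beta integral
  of \<open>v powr (1 + \<gamma> - s) * (1 + v) powr (- (\<gamma> + 1 + \<delta>))\<close> over \<open>v > 0\<close> (\<open>beta_integral_half_line\<close>). After an exchange
  of integrations the Cahen--Mellin formula evaluates the inner line integral to
  \<open>2 \<pi> (x v)\<^sup>\<alpha> e\<^sup>-\<^sup>x\<^sup>v\<close> (\<open>mellin_kernel_line_integral\<close>). The result does not depend on the separating line, so this
  also shows that the Meijer function does not. Scaling \<open>v\<close> by \<open>u\<close> relates the two integral
  representations.
\<close>

section \<open>Decay of the Gamma function on vertical lines\<close>

text \<open>
  Euler's integral, estimated under the integral sign.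
\<close>

lemma norm_Gamma_le_Gamma_Re:
  assumes "Re s > 0"
  shows "norm (Gamma s) \<le> Gamma (Re s)"
proof -
  let ?f = "\<lambda>t. complex_of_real t powr (s - 1) / of_real (exp t)"
  let ?g = "\<lambda>t. t powr (Re s - 1) / exp t"
  have f: "(?f has_integral Gamma s) {0..}"
    by (rule Gamma_integral_complex[OF assms])
  have g: "(?g has_integral Gamma (Re s)) {0..}"
    by (rule Gamma_integral_real[OF assms])
  have "norm (?f t) \<le> ?g t" if "t \<in> {0..}" for t
    using that by (simp add: norm_divide norm_powr_real_powr)
  then have "norm (integral {0..} ?f) \<le> integral {0..} ?g"
    using f g by (intro integral_norm_bound_integral) (auto simp: has_integral_integrable)
  then show ?thesis
    using f g by (simp add: integral_unique)
qed

text \<open>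
  Every factor of the Pochhammer product in \<open>\<Gamma>(s) = \<Gamma>(s + n) / (s (s + 1) \<dots> (s + n - 1))\<close> has modulus at least
  \<open>\<bar>Im s\<bar>\<close>. This gives decay of any polynomial order, which replaces Stirling's formula below, and
  it also reaches lines to the left of the imaginary axis.
\<close>

lemma norm_Gamma_mult_Im_power_le:
  assumes "Re s + real n > 0" "Im s \<noteq> 0"
  shows "norm (Gamma s) * \<bar>Im s\<bar> ^ n \<le> Gamma (Re s + real n)"
proof -
  have "s \<notin> \<int>\<^sub>\<le>\<^sub>0"
    using assms(2) by (auto elim!: nonpos_Ints_cases)
  then have "pochhammer s n * Gamma s = Gamma (s + of_nat n)"
    by (simp add: pochhammer_Gamma Gamma_eq_zero_iff)
  then have "norm (Gamma s) * norm (pochhammer s n) \<le> Gamma (Re s + real n)"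
    using norm_Gamma_le_Gamma_Re[of "s + of_nat n"] assms(1)
    by (metis Re_complex_of_real mult.commute norm_mult of_real_of_nat_eq plus_complex.sel(1))
  moreover have "\<bar>Im s\<bar> ^ n \<le> norm (pochhammer s n)"
  proof -
    have "(\<Prod>i<n. \<bar>Im s\<bar>) \<le> (\<Prod>i<n. norm (s + of_nat i))"
    proof (rule prod_mono)
      fix i show "0 \<le> \<bar>Im s\<bar> \<and> \<bar>Im s\<bar> \<le> norm (s + of_nat i)"
        using abs_Im_le_cmod[of "s + of_nat i"] by simp
    qed
    then show ?thesis
      by (simp add: pochhammer_prod prod_norm atLeast0LessThan)
  qed
  ultimately show ?thesis
    by (meson mult_left_mono norm_ge_zero order_trans)
qed

text \<open>
  The order of decay must not depend on the strip, so \<open>n\<close> is first enlarged until the strip,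
  shifted by that amount, lies in the right half-plane.
\<close>

lemma Gamma_vertical_decay:
  fixes c d :: real and n :: nat
  obtains C where "C \<ge> 0"
    and "\<And>s. c \<le> Re s \<Longrightarrow> Re s \<le> d \<Longrightarrow> \<bar>Im s\<bar> \<ge> 1 \<Longrightarrow> norm (Gamma s) \<le> C / \<bar>Im s\<bar> ^ n"
proof -
  obtain m :: nat where m: "real m > - c"
    using reals_Archimedean2 by blast
  define N where "N = n + m"
  have pos: "x + real N > 0" if "c \<le> x" for x
    using that m by (simp add: N_def)
  have "continuous_on {c..d} (\<lambda>x. Gamma (x + real N))"
    using pos nonpos_Ints_nonpos
    by (intro continuous_at_imp_continuous_on ballI isCont_Gamma continuous_intros) fastforce
  then have "bounded ((\<lambda>x. Gamma (x + real N)) ` {c..d})"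
    by (intro compact_imp_bounded compact_continuous_image) auto
  then obtain C where C: "C > 0" "\<And>x. x \<in> {c..d} \<Longrightarrow> norm (Gamma (x + real N)) \<le> C"
    unfolding bounded_pos by auto
  show ?thesis
  proof (rule that[of C])
    show "C \<ge> 0" using C by simp
    fix s :: complex assume s: "c \<le> Re s" "Re s \<le> d" "\<bar>Im s\<bar> \<ge> 1"
    have "norm (Gamma s) * \<bar>Im s\<bar> ^ n \<le> norm (Gamma s) * \<bar>Im s\<bar> ^ N"
      using s by (intro mult_left_mono power_increasing) (auto simp: N_def)
    also have "\<dots> \<le> Gamma (Re s + real N)"
      using s pos by (intro norm_Gamma_mult_Im_power_le) auto
    also have "\<dots> \<le> C" using C(2)[of "Re s"] s by auto
    finally show "norm (Gamma s) \<le> C / \<bar>Im s\<bar> ^ n"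
      using s by (simp add: field_simps)
  qed
qed

section \<open>Moving a vertical line of integration\<close>

lemma integrable_vertical_line:
  fixes f :: "complex \<Rightarrow> complex"
  assumes cont: "continuous_on {s. Re s = c} f"
    and decay: "\<And>s. Re s = c \<Longrightarrow> \<bar>Im s\<bar> \<ge> 1 \<Longrightarrow> norm (f s) \<le> C / (Im s)\<^sup>2"
  shows "integrable lborel (\<lambda>t. f (Complex c t))"
proof -
  have cont': "continuous_on A (\<lambda>t. f (Complex c t))" for A
    by (rule continuous_on_compose2[OF cont]) (auto simp: Complex_eq intro!: continuous_intros)
  have "bounded ((\<lambda>t. f (Complex c t)) ` {-1..1})"
    by (intro compact_imp_bounded compact_continuous_image cont') auto
  then obtain B where B: "B > 0" "\<And>t. t \<in> {-1..1} \<Longrightarrow> norm (f (Complex c t)) \<le> B"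
    unfolding bounded_pos by auto
  \<comment> \<open>The factor 2 pays for \<open>1 + t\<^sup>2 \<le> 2\<close> when \<open>\<bar>t\<bar> \<le> 1\<close> and for \<open>1 + t\<^sup>2 \<le> 2 t\<^sup>2\<close> otherwise.\<close>
  define K where "K = 2 * (B + \<bar>C\<bar>)"
  have I: "integrable lborel (\<lambda>t::real. K * inverse (1 + t\<^sup>2))"
    using integrable_inverse_1_plus_square by (auto simp: set_integrable_def einterval_def)
  show ?thesis
  proof (rule Bochner_Integration.integrable_bound[OF I])
    show "(\<lambda>t. f (Complex c t)) \<in> borel_measurable lborel"
      using cont'[of UNIV] by (simp add: borel_measurable_continuous_onI)
    show "AE t in lborel. norm (f (Complex c t)) \<le> norm (K * inverse (1 + t\<^sup>2))"
    proof (rule AE_I2)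
      fix t :: real
      have K: "norm (K * inverse (1 + t\<^sup>2)) = K / (1 + t\<^sup>2)"
        using B(1) by (simp add: K_def divide_inverse abs_mult)
      have "1 + t\<^sup>2 > 0" by (simp add: add_pos_nonneg)
      show "norm (f (Complex c t)) \<le> norm (K * inverse (1 + t\<^sup>2))"
      proof (cases "\<bar>t\<bar> \<le> 1")
        case True
        have "t\<^sup>2 \<le> 1" using True by (simp add: abs_square_le_1)
        have "norm (f (Complex c t)) \<le> B" using B(2)[of t] True by (simp add: abs_le_iff)
        also have "\<dots> \<le> (2 * (B + \<bar>C\<bar>)) / 2" by simp
        also have "\<dots> \<le> K / (1 + t\<^sup>2)" unfolding K_def
          using B(1) \<open>t\<^sup>2 \<le> 1\<close> \<open>1 + t\<^sup>2 > 0\<close> by (intro divide_left_mono) auto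
        finally show ?thesis unfolding K .
      next
        case False
        then have "t\<^sup>2 \<ge> 1" using abs_le_square_iff[of 1 t] by simp
        have "norm (f (Complex c t)) \<le> C / t\<^sup>2" using decay[of "Complex c t"] False by simp
        also have "\<dots> \<le> \<bar>C\<bar> / t\<^sup>2" by (intro divide_right_mono) auto
        also have "\<dots> = 2 * \<bar>C\<bar> / (2 * t\<^sup>2)" by simp
        also have "\<dots> \<le> 2 * \<bar>C\<bar> / (1 + t\<^sup>2)"
          using \<open>t\<^sup>2 \<ge> 1\<close> by (intro divide_left_mono) (auto intro!: mult_pos_pos add_pos_nonneg)
        also have "\<dots> \<le> K / (1 + t\<^sup>2)"
          using \<open>1 + t\<^sup>2 > 0\<close> B(1) by (intro divide_right_mono) (auto simp: K_def)
        finally show ?thesis unfolding K .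
      qed
    qed
  qed
qed

lemma integral_symmetric_interval_tendsto:
  fixes g :: "real \<Rightarrow> complex"
  assumes "integrable lborel g"
  shows "(\<lambda>n. integral {- real n..real n} g) \<longlonglongrightarrow> integral\<^sup>L lborel g"
proof -
  have "(\<lambda>n. integral\<^sup>L lborel (\<lambda>t. indicator {- real n..real n} t *\<^sub>R g t)) \<longlonglongrightarrow> integral\<^sup>L lborel g"
  proof (rule integral_dominated_convergence[where w = "\<lambda>t. norm (g t)"])
    show "AE t in lborel. (\<lambda>n. indicator {- real n..real n} t *\<^sub>R g t) \<longlonglongrightarrow> g t"
    proof (rule AE_I2)
      fix t :: real
      have "eventually (\<lambda>n. real n \<ge> \<bar>t\<bar>) sequentially"
        using filterlim_real_sequentially by (auto simp: filterlim_at_top)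
      then have "eventually (\<lambda>n. indicator {- real n..real n} t *\<^sub>R g t = g t) sequentially"
        by eventually_elim (auto simp: indicator_def)
      then show "(\<lambda>n. indicator {- real n..real n} t *\<^sub>R g t) \<longlonglongrightarrow> g t"
        by (rule tendsto_eventually)
    qed
  qed (use assms in \<open>auto simp: indicator_def\<close>)
  moreover have "integral\<^sup>L lborel (\<lambda>t. indicator {- real n..real n} t *\<^sub>R g t) = integral {- real n..real n} g" for n
  proof -
    have "set_integrable lborel {- real n..real n} g"
      using assms unfolding set_integrable_def by (intro integrable_mult_indicator) auto
    from set_borel_integral_eq_integral(2)[OF this] show ?thesis
      by (simp add: set_lebesgue_integral_def)
  qed
  ultimately show ?thesis by simp
qed

text \<open>
  The residue theorem on the rectangle with vertical sides \<open>Re s = c\<close> and \<open>Re s = d\<close> and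
  horizontal sides at height \<open>\<plusminus>n\<close>: by the quadratic decay, the horizontal sides contribute
  \<open>O(n\<^sup>-\<^sup>2)\<close>.
\<close>

lemma vertical_line_shift:
  fixes f :: "complex \<Rightarrow> complex"
  assumes order: "c' < c" "c < d" "d < d'"
    and pts: "finite pts" "\<And>p. p \<in> pts \<Longrightarrow> c < Re p \<and> Re p < d"
    and holo: "f holomorphic_on {s. c' < Re s \<and> Re s < d'} - pts"
    and decay: "\<And>s. c \<le> Re s \<Longrightarrow> Re s \<le> d \<Longrightarrow> \<bar>Im s\<bar> \<ge> 1 \<Longrightarrow> norm (f s) \<le> C / (Im s)\<^sup>2"
  shows "(\<integral>t. f (Complex d t) \<partial>lborel) - (\<integral>t. f (Complex c t) \<partial>lborel)
           = 2 * of_real pi * (\<Sum>p\<in>pts. residue f p)"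
proof -
  define S where "S = {s. c' < Re s \<and> Re s < d'}"
  have cont: "continuous_on A f" if "A \<subseteq> S - pts" for A
    using holo holomorphic_on_imp_continuous_on continuous_on_subset that unfolding S_def by blast
  have line: "integrable lborel (\<lambda>t. f (Complex e t))" if "e = c \<or> e = d" for e
  proof (rule integrable_vertical_line)
    show "continuous_on {s. Re s = e} f"
      using that order pts(2) by (intro cont) (auto simp: S_def)
    show "norm (f s) \<le> C / (Im s)\<^sup>2" if "Re s = e" "\<bar>Im s\<bar> \<ge> 1" for s
      using that \<open>e = c \<or> e = d\<close> order by (intro decay) auto
  qed
  define V where "V = (\<lambda>e n. integral {- real n..real n} (\<lambda>t. f (Complex e t)))"
  define H where "H = (\<lambda>n. contour_integral (linepath (Complex c (- real n)) (Complex d (- real n))) f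
     - contour_integral (linepath (Complex c (real n)) (Complex d (real n))) f)"
  define R where "R = (\<Sum>p\<in>pts. residue f p)"
  obtain B where B: "\<And>p. p \<in> pts \<Longrightarrow> \<bar>Im p\<bar> \<le> B"
    using finite_imp_bounded[of "Im ` pts"] pts(1) unfolding bounded_iff by auto
  have seg: "closed_segment (Complex c y) (Complex d y) = {s. Im s = y \<and> c \<le> Re s \<and> Re s \<le> d}" for y
    using order by (auto simp: closed_segment_same_Im closed_segment_eq_real_ivl)
  have segv: "closed_segment (Complex e (- real n)) (Complex e (real n))
      = {s. Re s = e \<and> Im s \<in> {- real n..real n}}" for e n
    by (auto simp: closed_segment_same_Re closed_segment_eq_real_ivl)
  have big: "eventually (\<lambda>n. real n > B \<and> n \<ge> 1) sequentially"
    by (intro eventually_conj eventually_ge_at_top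
        eventually_compose_filterlim[OF eventually_gt_at_top filterlim_real_sequentially])
  have key: "H n + \<i> * (V d n - V c n) = 2 * of_real pi * \<i> * R" if n: "real n > B" "n \<ge> 1" for n
  proof -
    define a b where "a = Complex c (- real n)" and "b = Complex d (real n)"
    have hi: "f contour_integrable_on linepath (Complex c y) (Complex d y)" if "\<bar>y\<bar> = real n" for y
      using that n B order
      by (intro contour_integrable_continuous_linepath cont) (force simp: S_def seg)
    have vi: "f contour_integrable_on linepath (Complex e (- real n)) (Complex e (real n))"
      if "e = c \<or> e = d" for e
      using that order pts(2)
      by (intro contour_integrable_continuous_linepath cont) (force simp: S_def segv)
    have rev: "contour_integral (linepath y x) f = - contour_integral (linepath x y) f" for x y
      using contour_integral_reversepath[of "linepath x y" f] by simp
    have revi: "f contour_integrable_on linepath y x" if "f contour_integrable_on linepath x y" for x y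
      using contour_integrable_reversepath[of "linepath x y" f] that by simp
    have ve: "contour_integral (linepath (Complex e (- real n)) (Complex e (real n))) f = \<i> * V e n" for e
      unfolding V_def using n by (intro contour_integral_linepath_same_Re) auto
    have "contour_integral (rectpath a b) f = H n + \<i> * (V d n - V c n)"
      unfolding rectpath_def a_def b_def Let_def
      using hi[of "real n"] hi[of "- real n"] vi[of c] vi[of d]
      by (simp add: revi rev[of "Complex c (real n)" "Complex d (real n)"]
          rev[of "Complex c (real n)" "Complex c (- real n)"] ve H_def algebra_simps)
    moreover have "contour_integral (rectpath a b) f
        = 2 * pi * \<i> * (\<Sum>p\<in>pts. winding_number (rectpath a b) p * residue f p)"
    proof (rule Residue_theorem[where S = S])
      have S: "S = {s. c' < Re s} \<inter> {s. Re s < d'}" by (auto simp: S_def)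
      show "open S" unfolding S by (intro open_Int open_halfspace_Re_gt open_halfspace_Re_lt)
      show "connected S" unfolding S
        by (intro convex_connected convex_Int convex_halfspace_Re_gt convex_halfspace_Re_lt)
      show "path_image (rectpath a b) \<subseteq> S - pts"
        using order n B pts(2) by (subst path_image_rectpath) (force simp: a_def b_def S_def)+
      show "\<forall>z. z \<notin> S \<longrightarrow> winding_number (rectpath a b) z = 0"
        using order n
        by (intro allI impI winding_number_rectpath_outside)
           (auto simp: a_def b_def S_def in_cbox_complex_iff)
    qed (use pts holo in \<open>auto simp: S_def\<close>)
    moreover have "winding_number (rectpath a b) p = 1" if "p \<in> pts" for p
      using B[OF that] pts(2)[OF that] n
      by (intro winding_number_rectpath) (auto simp: a_def b_def in_box_complex_iff)
    ultimately show ?thesis by (simp add: R_def)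
  qed
  have "H \<longlonglongrightarrow> 0"
  proof (rule Lim_null_comparison)
    show "eventually (\<lambda>n. norm (H n) \<le> 2 * (\<bar>C\<bar> / (real n)\<^sup>2 * (d - c))) sequentially"
      using big
    proof eventually_elim
      case (elim n)
      have "norm (contour_integral (linepath (Complex c y) (Complex d y)) f)
          \<le> \<bar>C\<bar> / (real n)\<^sup>2 * norm (Complex d y - Complex c y)" if "\<bar>y\<bar> = real n" for y
      proof (rule contour_integral_bound_linepath)
        show "f contour_integrable_on linepath (Complex c y) (Complex d y)"
          using that elim B order
          by (intro contour_integrable_continuous_linepath cont) (force simp: S_def seg)
        fix x assume "x \<in> closed_segment (Complex c y) (Complex d y)"
        then have x: "Im x = y" "c \<le> Re x" "Re x \<le> d" by (auto simp: seg)
        have "norm (f x) \<le> C / y\<^sup>2"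
          using decay[of x] x elim that by simp
        also have "y\<^sup>2 = (real n)\<^sup>2" using that by (metis power2_abs)
        also have "C / (real n)\<^sup>2 \<le> \<bar>C\<bar> / (real n)\<^sup>2" by (intro divide_right_mono) auto
        finally show "norm (f x) \<le> \<bar>C\<bar> / (real n)\<^sup>2" .
      qed auto
      moreover have "norm (Complex d y - Complex c y) = d - c" for y
      proof -
        have "Complex d y - Complex c y = of_real (d - c)" by (simp add: complex_eq_iff)
        then show ?thesis using order by (simp only: norm_of_real)
      qed
      ultimately have "norm (contour_integral (linepath (Complex c y) (Complex d y)) f)
          \<le> \<bar>C\<bar> / (real n)\<^sup>2 * (d - c)" if "\<bar>y\<bar> = real n" for y
        using that by simp
      from this[of "real n"] this[of "- real n"] show ?case
        unfolding H_def by (intro order_trans[OF norm_triangle_ineq4]) simp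
    qed
    show "(\<lambda>n. 2 * (\<bar>C\<bar> / (real n)\<^sup>2 * (d - c))) \<longlonglongrightarrow> 0"
      by real_asymp
  qed
  moreover have "V e \<longlonglongrightarrow> (\<integral>t. f (Complex e t) \<partial>lborel)" if "e = c \<or> e = d" for e
    unfolding V_def by (rule integral_symmetric_interval_tendsto[OF line[OF that]])
  ultimately have "(\<lambda>n. H n + \<i> * (V d n - V c n)) \<longlonglongrightarrow>
      0 + \<i> * ((\<integral>t. f (Complex d t) \<partial>lborel) - (\<integral>t. f (Complex c t) \<partial>lborel))"
    by (intro tendsto_intros) auto
  moreover have "(\<lambda>n. H n + \<i> * (V d n - V c n)) \<longlonglongrightarrow> 2 * of_real pi * \<i> * R"
    by (rule tendsto_eventually, rule eventually_mono[OF big]) (use key in auto)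
  ultimately have "\<i> * ((\<integral>t. f (Complex d t) \<partial>lborel) - (\<integral>t. f (Complex c t) \<partial>lborel))
      = \<i> * (2 * of_real pi * R)"
    using LIMSEQ_unique by (fastforce simp: algebra_simps)
  then show ?thesis unfolding R_def by (metis complex_i_not_zero mult_left_cancel)
qed

lemma partial_product_tendsto_0:
  fixes P b :: "nat \<Rightarrow> real"
  assumes step: "\<And>k. 0 \<le> P (Suc k) \<and> P (Suc k) \<le> b k * P k" and P0: "P 0 \<ge> 0"
    and b: "b \<longlonglongrightarrow> 0"
  shows "P \<longlonglongrightarrow> 0"
proof -
  have P: "P k \<ge> 0" for k
    using P0 step[of "k - 1"] by (cases "k = 0") auto
  obtain N where N: "\<And>n. n \<ge> N \<Longrightarrow> b n < 1/2"
    using order_tendstoD(2)[OF b, of "1/2"] by (auto simp: eventually_sequentially)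
  have "summable P"
  proof (rule summable_ratio_test[of "1/2"])
    fix n assume "n \<ge> N"
    then have "b n * P n \<le> 1/2 * P n"
      using N[of n] P[of n] by (intro mult_right_mono) auto
    then show "norm (P (Suc n)) \<le> 1/2 * norm (P n)"
      using step[of n] P[of n] by auto
  qed simp
  then show ?thesis by (rule summable_LIMSEQ_zero)
qed

text \<open>
  If each unit step to the left multiplies the integrand by at most \<open>b N\<close>, uniformly on the line,
  then the integral of its modulus picks up the partial products of \<open>b\<close>, which tend to 0.
\<close>

lemma shifted_line_integral_tendsto_0:
  fixes f :: "complex \<Rightarrow> complex"
  assumes int: "\<And>N::nat. integrable lborel (\<lambda>t. f (Complex (c - real N) t))"
    and step: "\<And>N t. norm (f (Complex (c - real (Suc N)) t)) \<le> b N * norm (f (Complex (c - real N) t))"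
    and b: "b \<longlonglongrightarrow> 0"
  shows "(\<lambda>N. \<integral>t. f (Complex (c - real N) t) \<partial>lborel) \<longlonglongrightarrow> 0"
proof -
  define P where "P = (\<lambda>N. \<integral>t. norm (f (Complex (c - real N) t)) \<partial>lborel)"
  have "P \<longlonglongrightarrow> 0"
  proof (rule partial_product_tendsto_0[OF _ _ b])
    show "P 0 \<ge> 0" by (simp add: P_def)
    fix k
    have "P (Suc k) \<le> (\<integral>t. b k * norm (f (Complex (c - real k) t)) \<partial>lborel)"
      unfolding P_def
    proof (rule integral_mono)
      show "integrable lborel (\<lambda>t. norm (f (Complex (c - real (Suc k)) t)))"
        by (rule integrable_norm[OF int])
      show "integrable lborel (\<lambda>t. b k * norm (f (Complex (c - real k) t)))"
        using integrable_norm[OF int[of k]] by (rule integrable_mult_right)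
    qed (rule step)
    moreover have "0 \<le> P (Suc k)"
      unfolding P_def by (intro Bochner_Integration.integral_nonneg norm_ge_zero)
    ultimately show "0 \<le> P (Suc k) \<and> P (Suc k) \<le> b k * P k"
      by (simp add: P_def del: of_nat_Suc)
  qed
  moreover have "norm (\<integral>t. f (Complex (c - real N) t) \<partial>lborel) \<le> P N" for N
    unfolding P_def by (rule integral_norm_bound)
  ultimately show ?thesis
    by (rule Lim_null_comparison[OF always_eventually[OF allI], rotated])
qed

text \<open>
  Letting the left line run to \<open>-\<infinity>\<close> in unit steps turns a Mellin--Barnes integral into the sum
  of its residues. The lines \<open>Re s = c - N\<close> must avoid the poles, and the set \<open>pts N\<close> collects
  those between the lines \<open>c - N\<close> and \<open>d\<close>.
\<close>

lemma line_integral_eq_residue_series: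
  fixes f :: "complex \<Rightarrow> complex" and pts :: "nat \<Rightarrow> complex set"
  assumes d: "c < d" "d < d'"
    and pts: "\<And>N. finite (pts N)"
      "\<And>N p. p \<in> pts N \<Longrightarrow> c - real N < Re p \<and> Re p < d"
    and holo: "\<And>N. \<exists>e < c - real N. f holomorphic_on {s. e < Re s \<and> Re s < d'} - pts N"
    and decay: "\<And>e. \<exists>C. \<forall>s. e \<le> Re s \<longrightarrow> Re s \<le> d \<longrightarrow> \<bar>Im s\<bar> \<ge> 1 \<longrightarrow> norm (f s) \<le> C / (Im s)\<^sup>2"
    and step: "\<And>N t. norm (f (Complex (c - real (Suc N)) t)) \<le> b N * norm (f (Complex (c - real N) t))"
    and b: "b \<longlonglongrightarrow> 0"
    and res: "(\<lambda>N. \<Sum>p\<in>pts N. residue f p) \<longlonglongrightarrow> L"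
  shows "(\<integral>t. f (Complex d t) \<partial>lborel) = 2 * of_real pi * L"
proof -
  define I where "I = (\<lambda>e. \<integral>t. f (Complex e t) \<partial>lborel)"
  have lt: "c - real N < d" for N
    using d(1) by linarith
  have shift: "I d - I (c - real N) = 2 * of_real pi * (\<Sum>p\<in>pts N. residue f p)" for N
  proof -
    obtain e where e: "e < c - real N" "f holomorphic_on {s. e < Re s \<and> Re s < d'} - pts N"
      using holo[of N] by blast
    obtain C where C: "\<forall>s. c - real N \<le> Re s \<longrightarrow> Re s \<le> d \<longrightarrow> \<bar>Im s\<bar> \<ge> 1 \<longrightarrow> norm (f s) \<le> C / (Im s)\<^sup>2"
      using decay[of "c - real N"] by blast
    show ?thesis
      unfolding I_def
      by (rule vertical_line_shift[OF e(1) lt d(2) pts e(2), of C]) (auto intro: C[rule_format])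
  qed
  have int: "integrable lborel (\<lambda>t. f (Complex (c - real N) t))" for N
  proof -
    obtain e where e: "e < c - real N" "f holomorphic_on {s. e < Re s \<and> Re s < d'} - pts N"
      using holo[of N] by blast
    obtain C where C: "\<forall>s. c - real N \<le> Re s \<longrightarrow> Re s \<le> d \<longrightarrow> \<bar>Im s\<bar> \<ge> 1 \<longrightarrow> norm (f s) \<le> C / (Im s)\<^sup>2"
      using decay[of "c - real N"] by blast
    show ?thesis
    proof (rule integrable_vertical_line)
      have "s \<in> {s. e < Re s \<and> Re s < d'} - pts N" if "Re s = c - real N" for s
        using e(1) lt[of N] d(2) pts(2)[of s N] that by auto
      then show "continuous_on {s. Re s = c - real N} f"
        by (intro continuous_on_subset[OF holomorphic_on_imp_continuous_on[OF e(2)]]) blast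
      fix s assume "Re s = c - real N" "\<bar>Im s\<bar> \<ge> 1"
      then show "norm (f s) \<le> C / (Im s)\<^sup>2"
        using lt[of N] by (intro C[rule_format]) auto
    qed
  qed
  have lim: "(\<lambda>N. I (c - real N)) \<longlonglongrightarrow> 0"
    unfolding I_def by (rule shifted_line_integral_tendsto_0[OF int step b])
  have "(\<lambda>N. I d - I (c - real N)) \<longlonglongrightarrow> I d - 0"
    by (intro tendsto_diff tendsto_const lim)
  moreover have "(\<lambda>N. I d - I (c - real N)) \<longlonglongrightarrow> 2 * of_real pi * L"
    unfolding shift by (intro tendsto_mult tendsto_const res)
  ultimately have "I d - 0 = 2 * of_real pi * L"
    by (rule LIMSEQ_unique)
  then show ?thesis by (simp add: I_def)
qed

section \<open>Gamma factors times a power\<close>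

lemma norm_powr_minus:
  assumes "y > 0"
  shows "norm (of_real y powr (- s)) = y powr (- Re s)"
  using assms by (simp add: norm_powr_real_powr)

lemma powr_minus_strip_bound:
  fixes y :: real
  assumes "y > 0"
  obtains C where "C > 0" "\<And>s. e \<le> Re s \<Longrightarrow> Re s \<le> d \<Longrightarrow> norm (of_real y powr (- s)) \<le> C"
proof -
  have "continuous_on {e..d} (\<lambda>x. y powr (- x))"
    using assms by (intro continuous_intros) auto
  then have "bounded ((\<lambda>x. y powr (- x)) ` {e..d})"
    by (intro compact_imp_bounded compact_continuous_image) auto
  then obtain C where C: "C > 0" "\<And>x. x \<in> {e..d} \<Longrightarrow> norm (y powr (- x)) \<le> C"
    unfolding bounded_pos by auto
  show ?thesis
    by (rule that[of C]) (use C assms in \<open>auto simp: norm_powr_minus\<close>)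
qed

text \<open>
  One Gamma factor alone already gives the quadratic decay, so the remaining factors \<open>g\<close> need only be
  bounded in strips.
\<close>

lemma Gamma_mult_decay:
  fixes y :: real
  assumes "y > 0" and g: "\<And>e d. \<exists>B\<ge>0. \<forall>s. e \<le> Re s \<longrightarrow> Re s \<le> d \<longrightarrow> \<bar>Im s\<bar> \<ge> 1 \<longrightarrow> norm (g s) \<le> B"
  shows "\<exists>C. \<forall>s. e \<le> Re s \<longrightarrow> Re s \<le> d \<longrightarrow> \<bar>Im s\<bar> \<ge> 1 \<longrightarrow>
           norm (Gamma (of_real A + s) * g s * of_real y powr (- s)) \<le> C / (Im s)\<^sup>2"
proof -
  obtain C1 where C1: "C1 \<ge> 0" "\<And>s. A + e \<le> Re s \<Longrightarrow> Re s \<le> A + d \<Longrightarrow> \<bar>Im s\<bar> \<ge> 1 \<Longrightarrow> norm (Gamma s) \<le> C1 / \<bar>Im s\<bar> ^ 2"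
    by (rule Gamma_vertical_decay[of "A + e" "A + d" 2]) blast
  obtain C2 where C2: "C2 > 0" "\<And>s. e \<le> Re s \<Longrightarrow> Re s \<le> d \<Longrightarrow> norm (of_real y powr (- s)) \<le> C2"
    by (rule powr_minus_strip_bound[OF assms(1), of e d]) blast
  obtain B where B: "B \<ge> 0" "\<And>s. e \<le> Re s \<Longrightarrow> Re s \<le> d \<Longrightarrow> \<bar>Im s\<bar> \<ge> 1 \<Longrightarrow> norm (g s) \<le> B"
    using g[of e d] by blast
  have "norm (Gamma (of_real A + s) * g s * of_real y powr (- s)) \<le> (C1 * B * C2) / (Im s)\<^sup>2"
    if s: "e \<le> Re s" "Re s \<le> d" "\<bar>Im s\<bar> \<ge> 1" for s
  proof -
    have "norm (Gamma (of_real A + s)) \<le> C1 / (Im s)\<^sup>2"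
      using C1(2)[of "of_real A + s"] s by simp
    then have "norm (Gamma (of_real A + s) * g s * of_real y powr (- s)) \<le> C1 / (Im s)\<^sup>2 * B * C2"
      unfolding norm_mult using C1(1) C2 B s by (intro mult_mono) auto
    then show ?thesis by simp
  qed
  then show ?thesis by blast
qed

text \<open>
  The poles of \<open>\<Gamma>(A + s)\<close> are simple, so a factor that is holomorphic there just scales the residue.
\<close>

lemma residue_Gamma_mult:
  fixes A :: real
  assumes "open U" "of_real (- A - real k) \<in> U" "g holomorphic_on U"
    "\<And>j::nat. j \<noteq> k \<Longrightarrow> of_real (- A - real j) \<notin> U"
  shows "residue (\<lambda>s. Gamma (of_real A + s) * g s) (of_real (- A - real k))
    = (-1) ^ k / fact k * g (of_real (- A - real k))"
proof (rule residue_simple'[OF assms(1,2)])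
  let ?p = "of_real (- A - real k) :: complex"
  have "of_real A + s \<notin> \<int>\<^sub>\<le>\<^sub>0" if "s \<in> U - {?p}" for s
  proof
    assume "of_real A + s \<in> \<int>\<^sub>\<le>\<^sub>0"
    then obtain j where "of_real A + s = - of_nat j" by (auto elim: nonpos_Ints_cases')
    then have "s = - of_nat j - of_real A" by (metis add_diff_cancel_left')
    then have "s = of_real (- A - real j)" by simp
    with that assms(4) show False by auto
  qed
  then show "(\<lambda>s. Gamma (of_real A + s) * g s) holomorphic_on U - {?p}"
    by (intro holomorphic_on_mult holomorphic_Gamma' holomorphic_on_add holomorphic_on_const
        holomorphic_on_ident holomorphic_on_subset[OF assms(3)]) auto
  have "((\<lambda>s. Gamma (of_real A + s) * ((of_real A + s) + of_nat k)) \<longlongrightarrow> (- 1) ^ k / fact k) (at ?p)"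
  proof (rule filterlim_compose[OF Gamma_residues])
    show "filterlim (\<lambda>s. of_real A + s) (at (- of_nat k)) (at ?p)"
      unfolding filterlim_at
    proof
      have "of_real A + s \<noteq> - of_nat k" if "s \<noteq> ?p" for s :: complex
      proof
        assume "of_real A + s = - of_nat k"
        then have "s = - of_nat k - of_real A" by (metis add_diff_cancel_left')
        with that show False by simp
      qed
      then show "eventually (\<lambda>s. of_real A + s \<in> UNIV \<and> of_real A + s \<noteq> - of_nat k) (at ?p)"
        by (auto simp: eventually_at_filter)
    qed (auto intro!: tendsto_eq_intros)
  qed
  moreover have "(g \<longlongrightarrow> g ?p) (at ?p)"
  proof -
    have "continuous_on U g" by (rule holomorphic_on_imp_continuous_on[OF assms(3)])
    then have "isCont g ?p" using assms(1,2) by (simp add: continuous_on_eq_continuous_at)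
    then show ?thesis by (simp add: isCont_def)
  qed
  ultimately have "((\<lambda>s. (Gamma (of_real A + s) * ((of_real A + s) + of_nat k)) * g s) \<longlongrightarrow> (- 1) ^ k / fact k * g ?p) (at ?p)"
    by (rule tendsto_mult)
  moreover have "of_real A + s + of_nat k = s - ?p" for s
    by simp
  ultimately show "((\<lambda>s. Gamma (of_real A + s) * g s * (s - ?p)) \<longlongrightarrow> (-1) ^ k / fact k * g ?p) (at ?p)"
    by (simp only: mult.assoc mult.commute[of "g _"])
qed

lemma Gamma_shift_down:
  fixes z :: complex
  assumes "z - 1 \<notin> \<int>\<^sub>\<le>\<^sub>0"
  shows "Gamma (z - 1) = Gamma z / (z - 1)"
proof -
  have "z - 1 \<noteq> 0" using assms by auto
  have "Gamma z = (z - 1) * Gamma (z - 1)" using Gamma_plus1[OF assms] by simp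
  with \<open>z - 1 \<noteq> 0\<close> show ?thesis by (metis nonzero_mult_div_cancel_left)
qed

lemma holomorphic_on_powr_minus [holomorphic_intros]:
  fixes y :: real
  assumes "y > 0"
  shows "(\<lambda>s. of_real y powr (- s)) holomorphic_on A"
  using assms unfolding powr_def by (auto intro!: holomorphic_intros)

lemma powr_minus_shift_down:
  fixes y :: real and s :: complex
  assumes "y > 0"
  shows "of_real y powr (- (s - 1)) = of_real y * of_real y powr (- s)"
  using assms by (simp add: powr_add powr_minus_divide powr_diff)

lemma powr_minus_of_real:
  assumes "y > (0::real)"
  shows "of_real y powr (- of_real x) = (of_real (y powr (- x)) :: complex)"
  using assms powr_of_real[of y "- x"] by simp

lemma Gamma_of_real_add_not_nonpos_Ints:
  fixes A :: real and s :: complex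
  assumes "\<And>k::nat. s \<noteq> of_real (- A - real k)"
  shows "of_real A + s \<notin> \<int>\<^sub>\<le>\<^sub>0"
proof
  assume "of_real A + s \<in> \<int>\<^sub>\<le>\<^sub>0"
  then obtain k where "of_real A + s = - of_nat k" by (auto elim: nonpos_Ints_cases')
  then have "s = - of_nat k - of_real A" by (metis add_diff_cancel_left')
  then have "s = of_real (- A - real k)" by simp
  with assms show False by blast
qed

section \<open>The Cahen--Mellin integral\<close>

text \<open>
  The residue of \<open>\<Gamma>(s) y\<^sup>-\<^sup>s\<close> at \<open>s = -k\<close> is \<open>(-y)\<^sup>k / k!\<close>, so the residue series is the exponential
  series. The lines \<open>Re s = -1/2 - N\<close> run midway between the poles, and a step to the left multiplies
  the integrand by \<open>y / (s - 1)\<close>, which is \<open>O(1/N)\<close>.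
\<close>

theorem Cahen_Mellin:
  assumes "d > 0" "y > 0"
  shows "(\<integral>t. Gamma (Complex d t) * of_real y powr (- Complex d t) \<partial>lborel)
           = 2 * of_real pi * of_real (exp (- y))"
proof -
  \<comment> \<open>The neutral 0 and 1 give the integrand the form \<open>\<Gamma>(A + s) g(s) y\<^sup>-\<^sup>s\<close> of the general lemmas.\<close>
  define f where "f = (\<lambda>s. Gamma (of_real 0 + s) * (1 * of_real y powr (- s)) :: complex)"
  define pole where "pole = (\<lambda>k. of_real (- 0 - real k) :: complex)"
  have inj: "inj pole" by (auto simp: pole_def inj_def)
  have "(\<integral>t. f (Complex d t) \<partial>lborel) = 2 * of_real pi * of_real (exp (- y))"
  proof (rule line_integral_eq_residue_series[where c = "- 1/2" and d' = "d + 1"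
        and pts = "\<lambda>N. pole ` {..N}" and b = "\<lambda>N. y / (real N + 1)"])
    show "\<exists>e < - 1 / 2 - real N. f holomorphic_on {s. e < Re s \<and> Re s < d + 1} - pole ` {..N}" for N
    proof (intro exI conjI)
      let ?S = "{s. - 1 - real N < Re s \<and> Re s < d + 1} - pole ` {..N}"
      show "- 1 - real N < - 1/2 - real N" by simp
      have "of_real 0 + s \<notin> \<int>\<^sub>\<le>\<^sub>0" if "s \<in> ?S" for s
      proof (rule Gamma_of_real_add_not_nonpos_Ints)
        fix k show "s \<noteq> of_real (- 0 - real k)"
          using that by (cases "k \<le> N") (auto simp: pole_def)
      qed
      then show "f holomorphic_on ?S"
        unfolding f_def using assms by (intro holomorphic_intros) auto
    qed
    show "\<exists>C. \<forall>s. e \<le> Re s \<longrightarrow> Re s \<le> d \<longrightarrow> \<bar>Im s\<bar> \<ge> 1 \<longrightarrow> norm (f s) \<le> C / (Im s)\<^sup>2" for e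
      unfolding f_def mult.assoc[symmetric] using assms
      by (intro Gamma_mult_decay) (auto intro!: exI[of _ "1::real"])
    show "norm (f (Complex (- 1 / 2 - real (Suc N)) t)) \<le> y / (real N + 1) * norm (f (Complex (- 1 / 2 - real N) t))" for N t
    proof -
      define s where "s = Complex (- 1 / 2 - real N) t"
      have s1: "Complex (- 1 / 2 - real (Suc N)) t = s - 1"
        by (simp add: s_def complex_eq_iff)
      have "s - 1 \<notin> \<int>\<^sub>\<le>\<^sub>0"
      proof
        assume "s - 1 \<in> \<int>\<^sub>\<le>\<^sub>0"
        then obtain k where "s - 1 = - of_nat k" by (auto elim: nonpos_Ints_cases')
        then have "Re (s - 1) = - real k" by simp
        then have "2 * real k = 2 * real N + 3" by (simp add: s_def)
        then have "2 * k = 2 * N + 3" by linarith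
        then show False by presburger
      qed
      then have "f (s - 1) = f s * (of_real y / (s - 1))"
        unfolding f_def using assms by (simp add: Gamma_shift_down powr_minus_shift_down del: minus_diff_eq)
      moreover have "real N + 1 \<le> norm (s - 1)"
        using abs_Re_le_cmod[of "s - 1"] by (simp add: s_def)
      then have "y / norm (s - 1) \<le> y / (real N + 1)"
        using assms by (intro divide_left_mono) (auto intro!: mult_pos_pos)
      then have "y / norm (s - 1) * norm (f s) \<le> y / (real N + 1) * norm (f s)"
        by (rule mult_right_mono) simp
      ultimately show ?thesis
        unfolding s1 s_def[symmetric] using assms
        by (simp add: norm_mult norm_divide mult.commute)
    qed
    show "(\<lambda>N. y / (real N + 1)) \<longlonglongrightarrow> 0" by real_asymp
    have "residue f (pole k) = of_real ((- y) ^ k / fact k)" for k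
      unfolding f_def pole_def
    proof (subst residue_Gamma_mult[where U = "ball (pole k) 1"])
      show "of_real (- 0 - real j) \<notin> ball (pole k) 1" if "j \<noteq> k" for j
      proof -
        have "dist (pole k) (of_real (- 0 - real j)) = \<bar>real j - real k\<bar>"
          unfolding pole_def dist_of_real by (simp add: dist_real_def)
        also have "\<dots> \<ge> 1" using that by linarith
        finally show ?thesis by simp
      qed
      show "(- 1) ^ k / fact k * (1 * complex_of_real y powr - complex_of_real (- 0 - real k)) = of_real ((- y) ^ k / fact k)"
        using assms by (subst powr_minus_of_real) (auto simp: powr_realpow power_minus')
    qed (use assms in \<open>auto simp: pole_def intro!: holomorphic_intros\<close>)
    then have "(\<Sum>p\<in>pole ` {..N}. residue f p) = of_real (\<Sum>k\<le>N. (- y) ^ k / fact k)" for N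
      by (subst sum.reindex) (auto intro: inj_on_subset[OF inj])
    moreover have "(\<lambda>N. \<Sum>k\<le>N. (- y) ^ k / fact k) \<longlonglongrightarrow> exp (- y)"
      using exp_converges[of "- y"] by (simp add: sums_def_le scaleR_conv_of_real field_simps)
    ultimately show "(\<lambda>N. \<Sum>p\<in>pole ` {..N}. residue f p) \<longlonglongrightarrow> of_real (exp (- y))"
      by (simp only: tendsto_of_real)
  qed (use assms in \<open>auto simp: pole_def\<close>)
  then show ?thesis by (simp add: f_def)
qed

section \<open>The residue series of the Mellin kernel\<close>

lemma hyp1F1_sums:
  fixes b :: real
  assumes "\<And>k::nat. b \<noteq> - real k"
  shows "(\<lambda>k. pochhammer a k / (pochhammer b k * fact k) * x ^ k) sums hyp1F1 a b x"
proof -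
  define t where "t = (\<lambda>k. pochhammer a k / (pochhammer b k * fact k) * x ^ k)"
  have "(\<lambda>k. (a + real k) / ((b + real k) * (real k + 1)) * x) \<longlonglongrightarrow> 0" by real_asymp
  then have "(\<lambda>k. norm ((a + real k) / ((b + real k) * (real k + 1)) * x)) \<longlonglongrightarrow> 0"
    by (rule tendsto_norm_zero)
  then obtain N where N: "\<And>k. k \<ge> N \<Longrightarrow> norm ((a + real k) / ((b + real k) * (real k + 1)) * x) < 1/2"
    using order_tendstoD(2)[of _ 0 sequentially "1/2"] by (fastforce simp: eventually_sequentially)
  have "summable t"
  proof (rule summable_ratio_test[of "1/2"])
    fix k assume "k \<ge> N"
    have "b + real k \<noteq> 0" using assms[of k] by linarith
    have "t (Suc k) = (a + real k) / ((b + real k) * (real k + 1)) * x * t k"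
      unfolding t_def using \<open>b + real k \<noteq> 0\<close>
      by (simp add: pochhammer_Suc divide_simps)
    then have "norm (t (Suc k)) = norm ((a + real k) / ((b + real k) * (real k + 1)) * x) * norm (t k)"
      by (simp only: norm_mult)
    also have "\<dots> \<le> 1/2 * norm (t k)"
      using N[OF \<open>k \<ge> N\<close>] by (intro mult_right_mono) auto
    finally show "norm (t (Suc k)) \<le> 1/2 * norm (t k)" .
  qed simp
  then show ?thesis unfolding hyp1F1_series t_def by (rule summable_sums)
qed

text \<open>
  This is how the coefficients \<open>1 / (b)\<^sub>k\<close> of the confluent series arise from Gamma values at
  \<open>z - k\<close>.
\<close>

lemma Gamma_minus_of_nat:
  fixes z :: real
  assumes "z \<notin> \<int>"
  shows "Gamma (z - real k) = (- 1) ^ k * Gamma z / pochhammer (1 - z) k"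
proof -
  have ni: "z - real k \<notin> \<int>\<^sub>\<le>\<^sub>0" 
  proof
    assume "z - real k \<in> \<int>\<^sub>\<le>\<^sub>0"
    then obtain n where "z - real k = of_int n" by (auto elim: nonpos_Ints_cases)
    then have "z = of_int (n + int k)" by simp
    with assms show False by (metis Ints_of_int)
  qed
  have nz: "pochhammer (1 - z) k \<noteq> 0"
  proof
    assume "pochhammer (1 - z) k = 0"
    then obtain j where "1 - z = - real j" by (auto simp: pochhammer_eq_0_iff)
    then have "z = of_nat (j + 1)" by simp
    with assms show False by (metis Ints_of_nat)
  qed
  have "pochhammer (1 - z) k = (- 1) ^ k * pochhammer (z - real k) k"
    using pochhammer_minus[of "z - 1" k] by simp
  moreover have "pochhammer (z - real k) k * Gamma (z - real k) = Gamma z"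
    using pochhammer_Gamma[OF ni, of k] ni by (simp add: Gamma_eq_zero_iff)
  ultimately have "pochhammer (1 - z) k * Gamma (z - real k) = (- 1) ^ k * Gamma z"
    by simp
  then show ?thesis using nz by (simp add: field_simps)
qed

text \<open>
  The integrand of the Meijer function in question, for \<open>A = \<alpha>\<close>, \<open>B = \<delta> - 1\<close> and \<open>D = 2 + \<gamma>\<close>. The
  poles of \<open>\<Gamma>(A + s)\<close> and \<open>\<Gamma>(B + s)\<close> run to the left, those of \<open>\<Gamma>(D - s)\<close> to the right.
\<close>

definition mellin_kernel :: "real \<Rightarrow> real \<Rightarrow> real \<Rightarrow> real \<Rightarrow> complex \<Rightarrow> complex" where
  "mellin_kernel A B D x s =
     Gamma (of_real A + s) * (Gamma (of_real B + s) * Gamma (of_real D - s)) * of_real x powr (- s)"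

lemma mellin_kernel_commute: "mellin_kernel A B D x s = mellin_kernel B A D x s"
  by (simp add: mellin_kernel_def)

lemma Gamma_of_real_minus_not_nonpos_Ints:
  assumes "Re s < D"
  shows "of_real D - s \<notin> \<int>\<^sub>\<le>\<^sub>0"
proof
  assume "of_real D - s \<in> \<int>\<^sub>\<le>\<^sub>0"
  then obtain k where "of_real D - s = - of_nat k" by (auto elim: nonpos_Ints_cases')
  then have "Re (of_real D - s) = Re (- of_nat k :: complex)" by simp
  then have "D - Re s = - real k" by simp
  with assms show False by simp
qed

lemma holomorphic_on_mellin_kernel:
  assumes "x > 0" and "\<And>s. s \<in> S \<Longrightarrow> Re s < D"
    and "\<And>s k. s \<in> S \<Longrightarrow> s \<noteq> of_real (- A - real k)"
    and "\<And>s k. s \<in> S \<Longrightarrow> s \<noteq> of_real (- B - real k)"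
  shows "mellin_kernel A B D x holomorphic_on S"
  unfolding mellin_kernel_def
  by (intro holomorphic_on_mult holomorphic_Gamma' holomorphic_on_add holomorphic_on_diff
      holomorphic_on_const holomorphic_on_ident holomorphic_on_powr_minus assms(1)
      Gamma_of_real_add_not_nonpos_Ints Gamma_of_real_minus_not_nonpos_Ints assms(2-4))

lemma Gamma_vertical_bounded:
  obtains C where "C \<ge> 0" "\<And>s. c \<le> Re s \<Longrightarrow> Re s \<le> d \<Longrightarrow> \<bar>Im s\<bar> \<ge> 1 \<Longrightarrow> norm (Gamma s) \<le> C"
  by (rule Gamma_vertical_decay[of c d 0]) auto

lemma mellin_kernel_decay:
  assumes "x > 0"
  shows "\<exists>C. \<forall>s. e \<le> Re s \<longrightarrow> Re s \<le> d \<longrightarrow> \<bar>Im s\<bar> \<ge> 1 \<longrightarrow> norm (mellin_kernel A B D x s) \<le> C / (Im s)\<^sup>2"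
  unfolding mellin_kernel_def
proof (rule Gamma_mult_decay[OF assms])
  fix e d :: real
  obtain C1 where C1: "C1 \<ge> 0" "\<And>s. B + e \<le> Re s \<Longrightarrow> Re s \<le> B + d \<Longrightarrow> \<bar>Im s\<bar> \<ge> 1 \<Longrightarrow> norm (Gamma s) \<le> C1"
    by (rule Gamma_vertical_bounded[of "B + e" "B + d"]) blast
  obtain C2 where C2: "C2 \<ge> 0" "\<And>s. D - d \<le> Re s \<Longrightarrow> Re s \<le> D - e \<Longrightarrow> \<bar>Im s\<bar> \<ge> 1 \<Longrightarrow> norm (Gamma s) \<le> C2"
    by (rule Gamma_vertical_bounded[of "D - d" "D - e"]) blast
  have "norm (Gamma (of_real B + s) * Gamma (of_real D - s)) \<le> C1 * C2"
    if "e \<le> Re s" "Re s \<le> d" "\<bar>Im s\<bar> \<ge> 1" for s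
    unfolding norm_mult using C1(1) C2(1) that
    by (intro mult_mono C1(2) C2(2)) auto
  then show "\<exists>C\<ge>0. \<forall>s. e \<le> Re s \<longrightarrow> Re s \<le> d \<longrightarrow> \<bar>Im s\<bar> \<ge> 1 \<longrightarrow>
      norm (Gamma (of_real B + s) * Gamma (of_real D - s)) \<le> C"
    using C1(1) C2(1) by (intro exI[of _ "C1 * C2"]) simp
qed

lemma integrable_mellin_kernel:
  assumes "x > 0" "- A < c" "- B < c" "c < D"
  shows "integrable lborel (\<lambda>t. mellin_kernel A B D x (Complex c t))"
proof -
  obtain C where C: "\<forall>s. c \<le> Re s \<longrightarrow> Re s \<le> c \<longrightarrow> \<bar>Im s\<bar> \<ge> 1 \<longrightarrow> norm (mellin_kernel A B D x s) \<le> C / (Im s)\<^sup>2"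
    using mellin_kernel_decay[OF assms(1)] by blast
  show ?thesis
  proof (rule integrable_vertical_line[where C = C])
    have "mellin_kernel A B D x holomorphic_on {s. Re s = c}"
      using assms by (intro holomorphic_on_mellin_kernel) auto
    then show "continuous_on {s. Re s = c} (mellin_kernel A B D x)"
      by (rule holomorphic_on_imp_continuous_on)
  qed (use C in auto)
qed

text \<open>
  Because \<open>A - B\<close> is not an integer, the two families of poles on the left are disjoint and all their
  poles are simple. The second family follows by exchanging \<open>A\<close> and \<open>B\<close>.
\<close>

lemma residue_mellin_kernel:
  assumes "x > 0" "- A < D" "A - B \<notin> \<int>"
  shows "residue (mellin_kernel A B D x) (of_real (- A - real k)) =
    of_real (Gamma (B - A) * Gamma (A + D) * x powr A *
      (pochhammer (A + D) k / (pochhammer (1 + A - B) k * fact k) * x ^ k))"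
proof -
  let ?p = "of_real (- A - real k) :: complex"
  define g where "g = (\<lambda>s::complex. Gamma (of_real B + s) * Gamma (of_real D - s) * of_real x powr (- s))"
  \<comment> \<open>A neighbourhood of the pole with no other pole of any factor: those of \<open>\<Gamma>(A + s)\<close> are 1 apart.\<close>
  define U where "U = ball ?p 1 \<inter> {s. Re s < D} \<inter> (\<lambda>s. of_real B + s) -` (- \<int>\<^sub>\<le>\<^sub>0)"
  have BA: "B - A \<notin> \<int>" using assms(3) by (metis Ints_minus minus_diff_eq)
  have "open U" unfolding U_def
    by (intro open_Int open_ball open_halfspace_Re_lt open_vimage)
       (auto intro!: continuous_intros simp: open_closed[symmetric])
  have "of_real B + ?p \<notin> \<int>\<^sub>\<le>\<^sub>0"
  proof
    assume "of_real B + ?p \<in> \<int>\<^sub>\<le>\<^sub>0"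
    then obtain j where "of_real B + ?p = - of_nat j" by (auto elim: nonpos_Ints_cases')
    then have "Re (of_real B + ?p) = Re (- of_nat j :: complex)" by simp
    then have "B - A = of_int (int k - int j)" by simp
    with BA show False by (metis Ints_of_int)
  qed
  then have pU: "?p \<in> U"
    using assms(2) by (simp add: U_def)
  have holo: "g holomorphic_on U"
    unfolding g_def
    by (intro holomorphic_on_mult holomorphic_Gamma' holomorphic_on_add holomorphic_on_diff
      holomorphic_on_const holomorphic_on_ident holomorphic_on_powr_minus assms(1)
      Gamma_of_real_minus_not_nonpos_Ints) (auto simp: U_def)
  have "mellin_kernel A B D x = (\<lambda>s. Gamma (of_real A + s) * g s)"
    by (rule ext) (simp add: mellin_kernel_def g_def mult.assoc)
  then have "residue (mellin_kernel A B D x) ?p = residue (\<lambda>s. Gamma (of_real A + s) * g s) ?p"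
    by (rule arg_cong)
  also have "\<dots> = (-1) ^ k / fact k * g ?p"
  proof (rule residue_Gamma_mult[OF \<open>open U\<close> pU holo])
    fix j assume "j \<noteq> k"
    have "dist ?p (of_real (- A - real j)) = \<bar>real j - real k\<bar>"
      unfolding dist_of_real by (simp add: dist_real_def)
    also have "\<dots> \<ge> 1" using \<open>j \<noteq> k\<close> by linarith
    finally show "of_real (- A - real j) \<notin> U" by (simp add: U_def)
  qed
  also have "g ?p = of_real (Gamma (B - A - real k) * Gamma (A + D + real k) * (x powr A * x ^ k))"
  proof -
    have "of_real B + ?p = of_real (B - A - real k)" "of_real D - ?p = of_real (A + D + real k)"
      by simp_all
    moreover have "of_real x powr (- ?p) = complex_of_real (x powr A * x ^ k)"
      using assms(1) by (subst powr_minus_of_real) (simp_all add: powr_add powr_realpow)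
    ultimately show ?thesis
      unfolding g_def by (simp only: Gamma_complex_of_real of_real_mult)
  qed
  also have "Gamma (B - A - real k) = (- 1) ^ k * Gamma (B - A) / pochhammer (1 + A - B) k"
    using Gamma_minus_of_nat[OF BA, of k] by (simp add: algebra_simps)
  also have "Gamma (A + D + real k) = Gamma (A + D) * pochhammer (A + D) k"
  proof -
    have "A + D \<notin> \<int>\<^sub>\<le>\<^sub>0" using assms(2) nonpos_Ints_nonpos[of "A + D"] by linarith
    then show ?thesis using pochhammer_Gamma[of "A + D" k] by (simp add: Gamma_eq_zero_iff)
  qed
  finally show ?thesis
    by (simp add: field_simps flip: power_add)
qed

text \<open>
  Each family of residues is a confluent series. A step to the left multiplies the kernel by
  \<open>x (D - s) / ((A + s - 1) (B + s - 1))\<close>. The factor \<open>\<Gamma>(D - s)\<close> grows in this direction, but this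
  is cancelled by \<open>\<Gamma>(B + s)\<close>: writing \<open>D - s = (B + D - 1) - (B + s - 1)\<close> shows that their joint
  contribution is bounded, and \<open>A + s - 1\<close> in the denominator makes the quotient \<open>O(1/N)\<close>.
\<close>

theorem mellin_barnes_residue_series:
  assumes x: "x > 0" and \<kappa>: "- A < \<kappa>" "- B < \<kappa>" "\<kappa> < D" and AB: "A - B \<notin> \<int>"
  shows "(\<integral>t. mellin_kernel A B D x (Complex \<kappa> t) \<partial>lborel) = 2 * of_real pi * of_real (
    Gamma (B - A) * Gamma (A + D) * x powr A * hyp1F1 (A + D) (1 + A - B) x +
    Gamma (A - B) * Gamma (B + D) * x powr B * hyp1F1 (B + D) (1 + B - A) x)"
proof -
  let ?f = "mellin_kernel A B D x"
  \<comment> \<open>The fractional part of \<open>B - A\<close> is \<open>1 - 2 \<eta>\<close>. The lines \<open>c - N\<close> are placed at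
     distance \<open>\<eta>\<close> to the left of a \<open>B\<close>-pole and \<open>1 - \<eta>\<close> to the left of an \<open>A\<close>-pole, hence at
     distance \<open>\<eta>\<close> to the right of the next \<open>A\<close>-pole. The offsets \<open>j1\<close> and \<open>j2\<close> express the
     different numbers of poles of the two families to the right of such a line.\<close>
  define j where "j = \<lfloor>B - A\<rfloor>"
  define \<eta> where "\<eta> = (1 - (B - A - of_int j)) / 2"
  have BA: "B - A \<notin> \<int>" using AB by (metis Ints_minus minus_diff_eq)
  have "of_int j < B - A" "B - A < of_int j + 1"
    using BA unfolding j_def by (metis Ints_of_int of_int_floor_le order_le_less, linarith)
  then have \<eta>: "0 < \<eta>" "\<eta> < 1/2" by (auto simp: \<eta>_def)
  define j1 j2 where "j1 = nat j" and "j2 = nat (- j)"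
  have j12: "of_int j = real j1 - real j2" unfolding j1_def j2_def by (cases "j \<ge> 0") auto
  define c where "c = - B - real j2 - \<eta>"
  have cA: "c = - A - real j1 - (1 - \<eta>)"
    using j12 unfolding c_def \<eta>_def by (simp add: field_simps)
  define pA pB where "pA = (\<lambda>k. of_real (- A - real k) :: complex)"
    and "pB = (\<lambda>k. of_real (- B - real k) :: complex)"
  have inj: "inj pA" "inj pB" by (auto simp: pA_def pB_def inj_def)
  define P where "P = (\<lambda>N. pA ` {..<N + j1 + 1} \<union> pB ` {..<N + j2 + 1})"
  have disj: "pA i \<noteq> pB k" for i k
  proof
    assume "pA i = pB k"
    then have "- A - real i = - B - real k" unfolding pA_def pB_def of_real_eq_iff .
    then have "B - A = of_int (int i - int k)" by simp
    with BA show False by (metis Ints_of_int)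
  qed
  define tA tB where
    "tA = (\<lambda>k. pochhammer (A + D) k / (pochhammer (1 + A - B) k * fact k) * x ^ k)"
    and "tB = (\<lambda>k. pochhammer (B + D) k / (pochhammer (1 + B - A) k * fact k) * x ^ k)"
  have resA: "residue ?f (pA k) = of_real (Gamma (B - A) * Gamma (A + D) * x powr A * tA k)" for k
    unfolding pA_def tA_def using x \<kappa> AB by (intro residue_mellin_kernel) auto
  have resB: "residue ?f (pB k) = of_real (Gamma (A - B) * Gamma (B + D) * x powr B * tB k)" for k
  proof -
    have "?f = mellin_kernel B A D x" by (rule ext) (rule mellin_kernel_commute)
    then show ?thesis
      unfolding pB_def tB_def using x \<kappa> BA residue_mellin_kernel[of x B D A k] by simp
  qed
  show ?thesis
  proof (rule line_integral_eq_residue_series[where c = c and d' = D and pts = P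
        and b = "\<lambda>N. x * (1 + \<bar>B + D - 1\<bar> / (real N + 1)) / (real N + 1)"])
    show "c < \<kappa>" using \<kappa>(2) \<eta> by (simp add: c_def)
    show "\<kappa> < D" by fact
    show "finite (P N)" for N by (simp add: P_def)
    show "c - real N < Re p \<and> Re p < \<kappa>" if p: "p \<in> P N" for N p
    proof -
      consider i where "p = pA i" "i < N + j1 + 1" | i where "p = pB i" "i < N + j2 + 1"
        using p by (auto simp: P_def)
      then show ?thesis
      proof cases
        case 1
        then have "real i \<le> real N + real j1" by linarith
        then show ?thesis using 1 \<eta> \<kappa> by (simp add: pA_def cA)
      next
        case 2
        then have "real i \<le> real N + real j2" by linarith
        then show ?thesis using 2 \<eta> \<kappa> by (simp add: pB_def c_def)
      qed
    qed
    show "\<exists>e < c - real N. ?f holomorphic_on {s. e < Re s \<and> Re s < D} - P N" for N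
    proof (intro exI conjI)
      show "c - real N - \<eta> < c - real N" using \<eta> by simp
      show "?f holomorphic_on {s. c - real N - \<eta> < Re s \<and> Re s < D} - P N"
      proof (rule holomorphic_on_mellin_kernel)
        fix s k assume s: "s \<in> {s. c - real N - \<eta> < Re s \<and> Re s < D} - P N"
        show "s \<noteq> of_real (- A - real k)"
        proof
          assume eq: "s = of_real (- A - real k)"
          then have "c - real N - \<eta> < - A - real k" using s by simp
          then have "real k < real (N + j1 + 1)" unfolding cA by simp
          then show False using s eq by (auto simp: P_def pA_def)
        qed
        show "s \<noteq> of_real (- B - real k)"
        proof
          assume eq: "s = of_real (- B - real k)"
          then have "c - real N - \<eta> < - B - real k" using s by simp
          then have "real k < real (N + j2 + 1)" unfolding c_def using \<eta> by simp
          then show False using s eq by (auto simp: P_def pB_def)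
        qed
      qed (use x in auto)
    qed
    show "\<exists>C. \<forall>s. e \<le> Re s \<longrightarrow> Re s \<le> \<kappa> \<longrightarrow> \<bar>Im s\<bar> \<ge> 1 \<longrightarrow> norm (?f s) \<le> C / (Im s)\<^sup>2" for e
      by (rule mellin_kernel_decay[OF x])
    show "norm (?f (Complex (c - real (Suc N)) t))
        \<le> x * (1 + \<bar>B + D - 1\<bar> / (real N + 1)) / (real N + 1) * norm (?f (Complex (c - real N) t))" for N t
    proof -
      define s where "s = Complex (c - real N) t"
      have s1: "Complex (c - real (Suc N)) t = s - 1"
        by (simp add: s_def complex_eq_iff)
      define u v w where "u = of_real A + s - 1" and "v = of_real B + s - 1" and "w = of_real D - s"
      have Re_u: "Re u = - (real j1 + real N + 1) - (1 - \<eta>)"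
        by (simp add: u_def s_def cA)
      have Re_v: "Re v = - (real j2 + real N + 1) - \<eta>"
        by (simp add: v_def s_def c_def)
      note Re_uv = Re_u Re_v
      have not_int: "z \<notin> \<int>\<^sub>\<le>\<^sub>0" if "Re z = - real m - \<theta>" "0 < \<theta>" "\<theta> < 1" for z :: complex and m \<theta>
      proof
        assume "z \<in> \<int>\<^sub>\<le>\<^sub>0"
        then obtain k where "z = - of_nat k" by (auto elim: nonpos_Ints_cases')
        then have "real k = real m + \<theta>" using that(1) by simp
        then have "real m < real k" "real k < real (m + 1)" using that by auto
        then show False by (simp only: of_nat_less_iff)
      qed
      have u: "u \<notin> \<int>\<^sub>\<le>\<^sub>0" by (rule not_int[of _ "j1 + N + 1" "1 - \<eta>"]) (use Re_uv \<eta> in auto)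
      have v: "v \<notin> \<int>\<^sub>\<le>\<^sub>0" by (rule not_int[of _ "j2 + N + 1" "\<eta>"]) (use Re_uv \<eta> in auto)
      have w: "w \<notin> \<int>\<^sub>\<le>\<^sub>0"
        unfolding w_def using \<open>c < \<kappa>\<close> \<kappa> by (intro Gamma_of_real_minus_not_nonpos_Ints) (simp add: s_def)
      have nu: "real N + 1 \<le> norm u" and nv: "real N + 1 \<le> norm v"
        using abs_Re_le_cmod[of u] abs_Re_le_cmod[of v] Re_uv \<eta> by auto
      have "Gamma (of_real A + (s - 1)) = Gamma (of_real A + s) / u"
        using Gamma_shift_down[of "of_real A + s"] u by (simp add: u_def add_diff_eq)
      moreover have "Gamma (of_real B + (s - 1)) = Gamma (of_real B + s) / v"
        using Gamma_shift_down[of "of_real B + s"] v by (simp add: v_def add_diff_eq)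
      moreover have "Gamma (of_real D - (s - 1)) = w * Gamma (of_real D - s)"
        using Gamma_plus1[OF w] by (simp add: w_def algebra_simps)
      ultimately have "?f (s - 1) = ?f s * (of_real x * w / (u * v))"
        unfolding mellin_kernel_def powr_minus_shift_down[OF x] by simp
      then have "norm (?f (s - 1)) = x * (norm w / norm v) / norm u * norm (?f s)"
        using x by (simp add: norm_mult norm_divide mult_ac)
      also have "\<dots> \<le> x * (1 + \<bar>B + D - 1\<bar> / (real N + 1)) / (real N + 1) * norm (?f s)"
      proof (intro mult_right_mono frac_le mult_left_mono)
        have "w = of_real (B + D - 1) - v" by (simp add: w_def v_def)
        then have "norm w \<le> \<bar>B + D - 1\<bar> + norm v"
          using norm_triangle_ineq4[of "of_real (B + D - 1)" v] by (simp only: norm_of_real) 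
        then have "norm w / norm v \<le> (\<bar>B + D - 1\<bar> + norm v) / norm v"
          by (rule divide_right_mono) simp
        also have "\<dots> = 1 + \<bar>B + D - 1\<bar> / norm v"
        proof -
          have "norm v \<noteq> 0" using nv by auto
          then show ?thesis by (simp add: field_simps)
        qed
        also have "\<dots> \<le> 1 + \<bar>B + D - 1\<bar> / (real N + 1)"
          using nv by (intro add_left_mono divide_left_mono) (auto intro!: mult_pos_pos)
        finally show "norm w / norm v \<le> 1 + \<bar>B + D - 1\<bar> / (real N + 1)" .
      qed (use x nu in auto)
      finally show ?thesis unfolding s1 s_def[symmetric] .
    qed
    show "(\<lambda>N. x * (1 + \<bar>B + D - 1\<bar> / (real N + 1)) / (real N + 1)) \<longlonglongrightarrow> 0"
      by real_asymp
    have sum: "(\<Sum>p\<in>P N. residue ?f p) = of_real (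
        Gamma (B - A) * Gamma (A + D) * x powr A * (\<Sum>k<N + (j1 + 1). tA k) +
        Gamma (A - B) * Gamma (B + D) * x powr B * (\<Sum>k<N + (j2 + 1). tB k))" for N
    proof -
      have "(\<Sum>p\<in>P N. residue ?f p)
          = (\<Sum>k<N + (j1 + 1). residue ?f (pA k)) + (\<Sum>k<N + (j2 + 1). residue ?f (pB k))"
        unfolding P_def using disj inj
        by (subst sum.union_disjoint) (auto simp: sum.reindex inj_on_def inj_def add.assoc)
      then show ?thesis
        by (simp only: resA resB of_real_add of_real_mult of_real_sum sum_distrib_left)
    qed
    have "tA sums hyp1F1 (A + D) (1 + A - B) x"
      unfolding tA_def
    proof (rule hyp1F1_sums)
      fix k show "1 + A - B \<noteq> - real k"
      proof
        assume "1 + A - B = - real k"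
        then have "A - B = of_int (- int k - 1)" by simp
        with AB show False by (metis Ints_of_int)
      qed
    qed
    moreover have "tB sums hyp1F1 (B + D) (1 + B - A) x"
      unfolding tB_def
    proof (rule hyp1F1_sums)
      fix k show "1 + B - A \<noteq> - real k"
      proof
        assume "1 + B - A = - real k"
        then have "B - A = of_int (- int k - 1)" by simp
        with BA show False by (metis Ints_of_int)
      qed
    qed
    ultimately show "(\<lambda>N. \<Sum>p\<in>P N. residue ?f p) \<longlonglongrightarrow> of_real (
        Gamma (B - A) * Gamma (A + D) * x powr A * hyp1F1 (A + D) (1 + A - B) x +
        Gamma (A - B) * Gamma (B + D) * x powr B * hyp1F1 (B + D) (1 + B - A) x)"
      unfolding sum sums_def
      by (intro tendsto_of_real tendsto_add tendsto_mult tendsto_const LIMSEQ_ignore_initial_segment)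
  qed
qed

section \<open>Gamma and beta integrals on the half-line\<close>

text \<open>
  The Mellin power \<open>v\<^sup>z\<close> on the half-line, extended by 0. Keeping the restriction \<open>v > 0\<close> inside the
  power makes it jointly measurable in \<open>(z, v)\<close> and turns half-line integrals into integrals over
  \<open>\<real>\<close>, as needed for Fubini's theorem.
\<close>

definition pos_powr :: "complex \<Rightarrow> real \<Rightarrow> complex" where
  "pos_powr z v = (if v > 0 then of_real v powr z else 0)"

lemma pos_powr_measurable [measurable (raw)]:
  assumes [measurable]: "f \<in> borel_measurable M" "g \<in> borel_measurable M"
  shows "(\<lambda>x. pos_powr (f x) (g x)) \<in> borel_measurable M"
proof -
  have "(\<lambda>x. pos_powr (f x) (g x)) = (\<lambda>x. if g x > 0 then exp (f x * of_real (ln (g x))) else 0)"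
    by (rule ext) (simp add: pos_powr_def powr_def Ln_of_real)
  then show ?thesis by simp
qed

lemma norm_pos_powr: "norm (pos_powr z v) = (if v > 0 then v powr Re z else 0)"
  by (simp add: pos_powr_def norm_powr_real_powr)

lemma pos_powr_add: "pos_powr (z + w) v = pos_powr z v * pos_powr w v"
  by (simp add: pos_powr_def powr_add)

lemma pos_powr_of_real: "pos_powr (of_real r) v = of_real (indicator {0<..} v * v powr r)"
  by (simp add: pos_powr_def indicator_def powr_of_real)

lemma Gamma_integral_scaled:
  fixes c :: real
  assumes "Re z > 0" "c > 0"
  shows "has_bochner_integral lborel (\<lambda>v. pos_powr (z - 1) v * of_real (exp (- c * v)))
           (Gamma z * of_real c powr (- z))"
proof -
  define f where "f = (\<lambda>v. pos_powr (z - 1) v * of_real (exp (- v)))"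
  have f_eq: "f v = indicator {0<..} v *\<^sub>R (of_real v powr (z - 1) / of_real (exp v))" for v
    by (simp add: f_def pos_powr_def exp_minus divide_inverse)
  have meas: "f \<in> borel_measurable lborel"
    unfolding f_def by measurable
  have int: "integrable lborel f"
  proof -
    have "integrable lebesgue f"
      using absolutely_integrable_Gamma_integral'[OF assms(1)] by (simp add: set_integrable_def f_eq[abs_def])
    then show ?thesis using integrable_completion[OF meas] by simp
  qed
  then have "(f has_integral integral\<^sup>L lborel f) UNIV"
    by (rule has_integral_integral_lborel)
  moreover have "(f has_integral Gamma z) UNIV"
  proof -
    have "f = (\<lambda>v. if v \<in> {0<..} then of_real v powr (z - 1) / of_real (exp v) else 0)"
      by (rule ext) (simp add: f_eq indicator_def)
    then show ?thesis
      using Gamma_integral_complex'[OF assms(1)] has_integral_restrict_UNIV by metis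
  qed
  ultimately have "integral\<^sup>L lborel f = Gamma z"
    by (rule has_integral_unique)
  then have "has_bochner_integral lborel f (Gamma z)"
    using int by (simp add: has_bochner_integral_iff)
  then have "has_bochner_integral lborel (\<lambda>v. f (0 + c * v)) (Gamma z /\<^sub>R \<bar>c\<bar>)"
    using assms(2) lborel_has_bochner_integral_real_affine_iff[of c f "Gamma z" 0] by simp
  then have "has_bochner_integral lborel (\<lambda>v. of_real c powr (1 - z) * f (0 + c * v))
      (of_real c powr (1 - z) * (Gamma z /\<^sub>R \<bar>c\<bar>))"
    by (rule has_bochner_integral_mult_right)
  also have "of_real c powr (1 - z) * (Gamma z /\<^sub>R \<bar>c\<bar>) = Gamma z * of_real c powr (- z)"
    using assms(2) by (simp add: powr_diff powr_minus scaleR_conv_of_real field_simps)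
  also have "(\<lambda>v. of_real c powr (1 - z) * f (0 + c * v)) = (\<lambda>v. pos_powr (z - 1) v * of_real (exp (- c * v)))"
  proof
    fix v
    show "of_real c powr (1 - z) * f (0 + c * v) = pos_powr (z - 1) v * of_real (exp (- c * v))"
    proof (cases "v > 0")
      case True
      then have "of_real (c * v) powr (z - 1) = of_real c powr (z - 1) * (of_real v powr (z - 1) :: complex)"
        using assms(2) by (simp add: powr_times_real)
      moreover have "of_real c powr (1 - z) * of_real c powr (z - 1) = (1 :: complex)"
        using assms(2) by (simp flip: powr_add)
      ultimately show ?thesis using True assms(2) by (simp add: f_def pos_powr_def)
    next
      case False
      then show ?thesis using assms(2) by (simp add: f_def pos_powr_def zero_less_mult_iff)
    qed
  qed
  finally show ?thesis .
qed

lemma norm_Gamma_integral_scaled: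
  fixes c :: real
  assumes "Re z > 0" "c > 0"
  shows "has_bochner_integral lborel (\<lambda>v. norm (pos_powr (z - 1) v) * exp (- c * v))
           (Gamma (Re z) * c powr (- Re z))"
proof -
  let ?g = "\<lambda>v. norm (pos_powr (z - 1) v) * exp (- c * v)"
  have eq: "pos_powr (of_real (Re z) - 1) v * of_real (exp (- c * v)) = of_real (?g v)" for v
    using pos_powr_of_real[of "Re z - 1" v] by (simp add: norm_pos_powr)
  have "has_bochner_integral lborel (\<lambda>v. complex_of_real (?g v)) (Gamma (of_real (Re z)) * of_real c powr (- of_real (Re z)))"
    using Gamma_integral_scaled[of "of_real (Re z)" c] assms by (simp only: eq) simp
  also have "Gamma (of_real (Re z)) * of_real c powr (- of_real (Re z)) = complex_of_real (Gamma (Re z) * c powr (- Re z))"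
    using assms(2) by (simp add: Gamma_complex_of_real powr_minus_of_real)
  finally have "integrable lborel (\<lambda>v. complex_of_real (?g v))"
    and "integral\<^sup>L lborel (\<lambda>v. complex_of_real (?g v)) = complex_of_real (Gamma (Re z) * c powr (- Re z))"
    unfolding has_bochner_integral_iff by blast+
  then show ?thesis
    unfolding has_bochner_integral_iff integral_complex_of_real of_real_eq_iff complex_of_real_integrable_eq
    by blast
qed

text \<open>
  Fubini's theorem for inner integrals that are known in closed form, \<open>N\<close> being that of the modulus.
\<close>

lemma lborel_Fubini:
  fixes f :: "real \<Rightarrow> real \<Rightarrow> complex"
  assumes meas: "case_prod f \<in> borel_measurable (lborel \<Otimes>\<^sub>M lborel)"
    and inner: "\<And>x. has_bochner_integral lborel (\<lambda>y. norm (f x y)) (N x)"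
    and outer: "integrable lborel N"
    and X: "\<And>x. (\<integral>y. f x y \<partial>lborel) = F x"
    and Y: "\<And>y. (\<integral>x. f x y \<partial>lborel) = G y"
  shows "integrable lborel G" and "integral\<^sup>L lborel F = integral\<^sup>L lborel G"
proof -
  have N: "(\<integral>y. norm (f x y) \<partial>lborel) = N x" for x
    using inner by (rule has_bochner_integral_integral_eq)
  have "integrable lborel (f x)" for x
  proof -
    have "f x \<in> borel_measurable lborel"
      using measurable_Pair2[OF meas] by simp
    then show ?thesis
      using inner[of x] by (simp add: has_bochner_integral_iff integrable_norm_iff)
  qed
  then have int: "integrable (lborel \<Otimes>\<^sub>M lborel) (case_prod f)"
    using outer by (intro lborel_pair.Fubini_integrable meas) (simp_all add: N)
  show "integral\<^sup>L lborel F = integral\<^sup>L lborel G"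
    using lborel_pair.Fubini_integral[OF int] by (simp add: X Y)
  show "integrable lborel G"
    using lborel_pair.integrable_snd[OF int] by (simp add: Y)
qed

text \<open>
  Euler's double integral of \<open>w\<^sup>q\<^sup>-\<^sup>1 e\<^sup>-\<^sup>w v\<^sup>z\<^sup>-\<^sup>1 e\<^sup>-\<^sup>w\<^sup>v\<close>: integrating first over \<open>w\<close> gives
  \<open>\<Gamma>(q) v\<^sup>z\<^sup>-\<^sup>1 (1 + v)\<^sup>-\<^sup>q\<close>, and integrating first over \<open>v\<close> gives \<open>\<Gamma>(z) w\<^sup>q\<^sup>-\<^sup>z\<^sup>-\<^sup>1 e\<^sup>-\<^sup>w\<close>.
\<close>

lemma beta_integral_half_line:
  fixes q :: real
  assumes "0 < Re z" "Re z < q"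
  shows "has_bochner_integral lborel (\<lambda>v. pos_powr (z - 1) v * of_real ((1 + v) powr (- q)))
           (Gamma z * Gamma (of_real q - z) / of_real (Gamma q))"
proof -
  define f where "f = (\<lambda>w v. pos_powr (of_real q - 1) w * of_real (exp (- w)) *
     (pos_powr (z - 1) v * of_real (exp (- w * v))))"
  define G where "G = (\<lambda>v. of_real (Gamma q) * (pos_powr (z - 1) v * of_real ((1 + v) powr (- q))))"
  have q: "q > 0" using assms by simp
  have meas: "case_prod f \<in> borel_measurable (lborel \<Otimes>\<^sub>M lborel)"
    unfolding f_def by measurable
  have pw: "pos_powr (of_real q - 1) w * of_real w powr (- z) = pos_powr (of_real q - z - 1) w" for w
    using pos_powr_add[of "of_real q - 1" "- z" w] by (simp add: pos_powr_def algebra_simps)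
  have pw': "norm (pos_powr (of_real q - 1) w) * w powr (- Re z) = norm (pos_powr (of_real q - z - 1) w)" for w
    by (simp add: norm_pos_powr flip: powr_add) (simp add: algebra_simps)
  have inner: "has_bochner_integral lborel (\<lambda>v. norm (f w v))
      (Gamma (Re z) * (norm (pos_powr (of_real q - z - 1) w) * exp (- 1 * w)))" for w
  proof (cases "w > 0")
    case True
    have "has_bochner_integral lborel (\<lambda>v. norm (pos_powr (of_real q - 1) w) * exp (- w) *
        (norm (pos_powr (z - 1) v) * exp (- w * v)))
        (norm (pos_powr (of_real q - 1) w) * exp (- w) * (Gamma (Re z) * w powr (- Re z)))"
      by (rule has_bochner_integral_mult_right[OF norm_Gamma_integral_scaled[OF assms(1) True]])
    then show ?thesis
      unfolding pw'[symmetric] f_def by (simp add: norm_mult mult_ac)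
  next
    case False
    then show ?thesis by (auto simp: f_def pos_powr_def)
  qed
  have outer: "integrable lborel (\<lambda>w. Gamma (Re z) * (norm (pos_powr (of_real q - z - 1) w) * exp (- 1 * w)))"
    using norm_Gamma_integral_scaled[of "of_real q - z" 1] assms
    by (intro integrable_mult_right) (simp add: has_bochner_integral_iff)
  have X: "(\<integral>v. f w v \<partial>lborel) = Gamma z * (pos_powr (of_real q - z - 1) w * of_real (exp (- 1 * w)))" for w
  proof (cases "w > 0")
    case True
    show ?thesis
      unfolding f_def pw[symmetric]
      by (subst integral_mult_right_zero,
          subst has_bochner_integral_integral_eq[OF Gamma_integral_scaled[OF assms(1) True]])
         (simp add: mult_ac)
  next
    case False
    then show ?thesis by (simp add: f_def pos_powr_def)
  qed
  have Y: "(\<integral>w. f w v \<partial>lborel) = G v" for v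
  proof (cases "v > 0")
    case True
    have "f w v = pos_powr (z - 1) v * (pos_powr (of_real q - 1) w * of_real (exp (- (1 + v) * w)))" for w
      unfolding f_def by (simp add: exp_add[symmetric] algebra_simps flip: of_real_mult)
    then have "(\<integral>w. f w v \<partial>lborel)
        = pos_powr (z - 1) v * (\<integral>w. pos_powr (of_real q - 1) w * of_real (exp (- (1 + v) * w)) \<partial>lborel)"
      by simp
    also have "(\<integral>w. pos_powr (of_real q - 1) w * of_real (exp (- (1 + v) * w)) \<partial>lborel)
        = Gamma (of_real q) * of_real (1 + v) powr (- of_real q)"
      using True q by (intro has_bochner_integral_integral_eq Gamma_integral_scaled) auto
    also have "\<dots> = of_real (Gamma q * (1 + v) powr (- q))"
      using True powr_minus_of_real[of "1 + v" q] by (simp add: Gamma_complex_of_real)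
    finally show ?thesis by (simp add: G_def mult_ac)
  next
    case False
    then show ?thesis by (simp add: f_def G_def pos_powr_def)
  qed
  have "integrable lborel G"
    by (rule lborel_Fubini(1)[OF meas inner outer X Y])
  moreover have "integral\<^sup>L lborel G = Gamma z * Gamma (of_real q - z)"
  proof -
    have "has_bochner_integral lborel (\<lambda>w. pos_powr (of_real q - z - 1) w * of_real (exp (- 1 * w)))
        (Gamma (of_real q - z) * of_real 1 powr - (of_real q - z))"
      by (rule Gamma_integral_scaled) (use assms in auto)
    then have "(\<integral>w. Gamma z * (pos_powr (of_real q - z - 1) w * of_real (exp (- 1 * w))) \<partial>lborel)
        = Gamma z * Gamma (of_real q - z)"
      by (simp add: has_bochner_integral_integral_eq)
    then show ?thesis
      unfolding lborel_Fubini(2)[OF meas inner outer X Y] .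
  qed
  ultimately have "has_bochner_integral lborel G (Gamma z * Gamma (of_real q - z))"
    by (simp add: has_bochner_integral_iff)
  then have "has_bochner_integral lborel (\<lambda>v. inverse (of_real (Gamma q)) * G v)
      (inverse (of_real (Gamma q)) * (Gamma z * Gamma (of_real q - z)))"
    by (rule has_bochner_integral_mult_right)
  moreover have "Gamma q \<noteq> 0" using Gamma_real_pos[OF q] by simp
  then have "inverse (of_real (Gamma q)) * G v = pos_powr (z - 1) v * of_real ((1 + v) powr (- q))" for v
    unfolding G_def by simp
  ultimately show ?thesis by (simp add: divide_inverse mult_ac)
qed

section \<open>The line integral as an integral over the half-line\<close>

text \<open>
  The beta integral expands \<open>\<Gamma>(B + s) \<Gamma>(D - s) / \<Gamma>(B + D)\<close> as an integral over \<open>v\<close>. After exchanging the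
  two integrations, the line integral of \<open>\<Gamma>(A + s) (x v)\<^sup>-\<^sup>s\<close> is of Cahen--Mellin type. On a fixed
  line the modulus of the integrand is the product of a function of \<open>t\<close> and a function of \<open>v\<close>, both
  integrable, so the exchange is justified. The right-hand side no longer contains \<open>\<kappa>\<close>.
\<close>

theorem mellin_kernel_line_integral:
  assumes x: "x > 0" and \<kappa>: "- A < \<kappa>" "- B < \<kappa>" "\<kappa> < D"
  defines "h \<equiv> \<lambda>v. indicator {0<..} v * (v powr (A + D - 1) * (1 + v) powr (- (B + D)) * exp (- x * v))"
  shows "integrable lborel h"
    and "(\<integral>t. mellin_kernel A B D x (Complex \<kappa> t) \<partial>lborel)
      = 2 * of_real pi * of_real (Gamma (B + D) * x powr A * integral\<^sup>L lborel h)"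
proof -
  define q where "q = B + D"
  have q: "q > 0" using \<kappa> by (simp add: q_def)
  then have Gq: "Gamma q > 0" by (rule Gamma_real_pos)
  define E where "E = (\<lambda>t. Gamma (Complex (A + \<kappa>) t) * of_real x powr (- Complex \<kappa> t))"
  define f where "f = (\<lambda>t v. E t * (pos_powr (of_real D - Complex \<kappa> t - 1) v * of_real ((1 + v) powr (- q))))"
  have E_cont: "continuous_on UNIV E"
  proof -
    have "Complex (A + \<kappa>) t \<notin> \<int>\<^sub>\<le>\<^sub>0" for t
    proof
      assume "Complex (A + \<kappa>) t \<in> \<int>\<^sub>\<le>\<^sub>0"
      then obtain k where "Complex (A + \<kappa>) t = - of_nat k" by (auto elim: nonpos_Ints_cases')
      then have "A + \<kappa> = - real k" by (simp add: complex_eq_iff)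
      with \<kappa>(1) show False by simp
    qed
    then show ?thesis
      unfolding E_def using x
      by (intro continuous_at_imp_continuous_on ballI continuous_intros) (auto simp: Complex_eq intro!: continuous_intros)
  qed
  have [measurable]: "E \<in> borel_measurable borel"
    using E_cont by (rule borel_measurable_continuous_onI)
  have [measurable]: "(\<lambda>t. Complex \<kappa> t) \<in> borel_measurable borel"
    by (rule borel_measurable_continuous_onI) (auto simp: Complex_eq intro!: continuous_intros)
  have E_int: "integrable lborel (\<lambda>t. norm (E t))"
  proof -
    have "\<exists>C. \<forall>s. \<kappa> \<le> Re s \<longrightarrow> Re s \<le> \<kappa> \<longrightarrow> \<bar>Im s\<bar> \<ge> 1 \<longrightarrow>
        norm (Gamma (of_real A + s) * 1 * of_real x powr (- s)) \<le> C / (Im s)\<^sup>2"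
      by (rule Gamma_mult_decay[OF x]) (auto intro: exI[of _ "1::real"])
    then obtain C where C: "\<forall>s. \<kappa> \<le> Re s \<longrightarrow> Re s \<le> \<kappa> \<longrightarrow> \<bar>Im s\<bar> \<ge> 1 \<longrightarrow>
        norm (Gamma (of_real A + s) * 1 * of_real x powr (- s)) \<le> C / (Im s)\<^sup>2"
      by blast
    have "integrable lborel (\<lambda>t. Gamma (of_real A + Complex \<kappa> t) * 1 * of_real x powr (- Complex \<kappa> t))"
    proof (rule integrable_vertical_line)
      have "(\<lambda>s. Gamma (of_real A + s) * 1 * of_real x powr (- s)) holomorphic_on {s. Re s = \<kappa>}"
        using \<kappa>(1) x by (intro holomorphic_intros Gamma_of_real_add_not_nonpos_Ints) auto
      then show "continuous_on {s. Re s = \<kappa>} (\<lambda>s. Gamma (of_real A + s) * 1 * of_real x powr (- s))"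
        by (rule holomorphic_on_imp_continuous_on)
    qed (use C in auto)
    moreover have "of_real A + Complex \<kappa> t = Complex (A + \<kappa>) t" for t
      by (simp add: complex_eq_iff)
    ultimately show ?thesis by (simp add: E_def)
  qed
  have meas: "case_prod f \<in> borel_measurable (lborel \<Otimes>\<^sub>M lborel)"
    unfolding f_def by measurable
  define K where "K = (\<integral>v. norm (pos_powr (of_real (D - \<kappa>) - 1) v * of_real ((1 + v) powr (- q))) \<partial>lborel)"
  have inner: "has_bochner_integral lborel (\<lambda>v. norm (f t v)) (norm (E t) * K)" for t
  proof -
    have "norm (pos_powr (of_real D - Complex \<kappa> t - 1) v) = norm (pos_powr (of_real (D - \<kappa>) - 1) v)" for v
      by (simp add: norm_pos_powr)
    then have eq: "norm (f t v) = norm (E t) * norm (pos_powr (of_real (D - \<kappa>) - 1) v * of_real ((1 + v) powr (- q)))" for v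
      by (simp add: f_def norm_mult)
    have "integrable lborel (\<lambda>v. pos_powr (of_real (D - \<kappa>) - 1) v * of_real ((1 + v) powr (- q)))"
      using beta_integral_half_line[of "of_real (D - \<kappa>)" q] \<kappa>
      by (simp add: has_bochner_integral_iff q_def)
    then show ?thesis
      unfolding eq K_def by (intro has_bochner_integral_mult_right) (simp add: has_bochner_integral_iff)
  qed
  have outer: "integrable lborel (\<lambda>t. norm (E t) * K)"
    using E_int by (rule integrable_mult_left)
  have X: "(\<integral>v. f t v \<partial>lborel) = mellin_kernel A B D x (Complex \<kappa> t) / of_real (Gamma q)" for t
  proof -
    let ?s = "Complex \<kappa> t"
    have "(\<integral>v. f t v \<partial>lborel) = E t * (Gamma (of_real D - ?s) * Gamma (of_real q - (of_real D - ?s)) / of_real (Gamma q))"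
      unfolding f_def
      by (subst integral_mult_right_zero, subst has_bochner_integral_integral_eq[OF beta_integral_half_line])
         (use \<kappa> in \<open>auto simp: q_def\<close>)
    moreover have "of_real q - (of_real D - ?s) = of_real B + ?s" by (simp add: q_def)
    moreover have "Complex (A + \<kappa>) t = of_real A + ?s" by (simp add: complex_eq_iff)
    ultimately show ?thesis by (simp add: E_def mellin_kernel_def)
  qed
  have Y: "(\<integral>t. f t v \<partial>lborel) = of_real (2 * pi * x powr A * h v)" for v
  proof (cases "v > 0")
    case True
    have xv: "x * v > 0" using x True by simp
    have "f t v = of_real ((x * v) powr A * (v powr (D - 1) * (1 + v) powr (- q))) *
        (Gamma (Complex (A + \<kappa>) t) * of_real (x * v) powr (- Complex (A + \<kappa>) t))" for t
    proof -
      let ?s = "Complex \<kappa> t"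
      have c: "Complex (A + \<kappa>) t = of_real A + ?s" by (simp add: complex_eq_iff)
      have "pos_powr (of_real D - ?s - 1) v = of_real (v powr (D - 1)) * of_real v powr (- ?s)"
      proof -
        have "of_real D - ?s - 1 = of_real (D - 1) + (- ?s)" by simp
        then show ?thesis
          using True by (simp only: pos_powr_add pos_powr_of_real) (simp add: pos_powr_def)
      qed
      moreover have "of_real (x * v) powr (- (of_real A + ?s))
          = of_real ((x * v) powr (- A)) * (of_real x powr (- ?s) * of_real v powr (- ?s))"
      proof -
        have "of_real (x * v) powr (- (of_real A + ?s)) = of_real (x * v) powr (- of_real A) * of_real (x * v) powr (- ?s)"
          by (simp flip: powr_add)
        also have "of_real (x * v) powr (- of_real A) = complex_of_real ((x * v) powr (- A))"
          by (rule powr_minus_of_real[OF xv])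
        also have "of_real (x * v) powr (- ?s) = of_real x powr (- ?s) * of_real v powr (- ?s)"
          using x True by (simp add: powr_times_real)
        finally show ?thesis .
      qed
      moreover have "complex_of_real ((x * v) powr A) * of_real ((x * v) powr (- A)) = 1"
        using x True by (simp flip: of_real_mult powr_add)
      ultimately show ?thesis
        unfolding f_def E_def c by (simp add: mult_ac)
    qed
    then have "(\<integral>t. f t v \<partial>lborel) = of_real ((x * v) powr A * (v powr (D - 1) * (1 + v) powr (- q))) *
        (\<integral>t. Gamma (Complex (A + \<kappa>) t) * of_real (x * v) powr (- Complex (A + \<kappa>) t) \<partial>lborel)"
      by simp
    also have "(\<integral>t. Gamma (Complex (A + \<kappa>) t) * of_real (x * v) powr (- Complex (A + \<kappa>) t) \<partial>lborel)
        = 2 * of_real pi * of_real (exp (- (x * v)))"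
      using \<kappa>(1) xv by (intro Cahen_Mellin) auto
    also have "of_real ((x * v) powr A * (v powr (D - 1) * (1 + v) powr (- q))) * (2 * of_real pi * of_real (exp (- (x * v))))
        = complex_of_real (2 * pi * x powr A * h v)"
    proof -
      have "(x * v) powr A * v powr (D - 1) = x powr A * v powr (A + D - 1)"
        using x True by (simp add: powr_mult powr_add powr_diff)
      then have "(x * v) powr A * (v powr (D - 1) * (1 + v) powr (- q)) * (2 * pi * exp (- (x * v)))
          = 2 * pi * x powr A * h v"
        using True by (simp add: h_def q_def mult_ac)
      moreover have "of_real P * (2 * of_real pi * of_real e) = complex_of_real (P * (2 * pi * e))" for P e
        by simp
      ultimately show ?thesis by (simp only:)
    qed
    finally show ?thesis .
  next
    case False
    then show ?thesis by (simp add: f_def h_def pos_powr_def)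
  qed
  have "integrable lborel (\<lambda>v. complex_of_real (2 * pi * x powr A * h v))"
    by (rule lborel_Fubini(1)[OF meas inner outer X Y])
  then have "integrable lborel (\<lambda>v. 2 * pi * x powr A * h v)"
    by (simp only: complex_of_real_integrable_eq)
  then show "integrable lborel h"
    using x by (simp add: integrable_mult_right_iff)
  have "(\<integral>t. mellin_kernel A B D x (Complex \<kappa> t) / of_real (Gamma q) \<partial>lborel)
      = (\<integral>v. complex_of_real (2 * pi * x powr A * h v) \<partial>lborel)"
    by (rule lborel_Fubini(2)[OF meas inner outer X Y])
  also have "\<dots> = of_real (2 * pi * x powr A * integral\<^sup>L lborel h)"
    by (simp only: integral_complex_of_real integral_mult_right_zero)
  finally have eq: "(\<integral>t. mellin_kernel A B D x (Complex \<kappa> t) / of_real (Gamma q) \<partial>lborel)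
      = complex_of_real (2 * pi * x powr A * integral\<^sup>L lborel h)" .
  show "(\<integral>t. mellin_kernel A B D x (Complex \<kappa> t) \<partial>lborel)
      = 2 * of_real pi * of_real (Gamma (B + D) * x powr A * integral\<^sup>L lborel h)"
  proof -
    let ?I = "\<integral>t. mellin_kernel A B D x (Complex \<kappa> t) \<partial>lborel"
    have "?I / of_real (Gamma q) = complex_of_real (2 * pi * x powr A * integral\<^sup>L lborel h)"
      using eq by (simp only: integral_divide_zero)
    then have "?I = complex_of_real (2 * pi * x powr A * integral\<^sup>L lborel h) * of_real (Gamma q)"
      using Gq by (metis nonzero_divide_eq_eq of_real_eq_0_iff order_less_irrefl)
    then show ?thesis by (simp add: q_def mult_ac)
  qed
qed

section \<open>The Meijer function\<close>

lemma is_pole_Gamma_add_imp: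
  fixes A :: real
  assumes "is_pole (\<lambda>s. Gamma (of_real A + s)) (w :: complex)"
  shows "Re w \<le> - A"
proof (rule ccontr)
  assume "\<not> Re w \<le> - A"
  then have "w \<in> {s. Re s > - A}" by simp
  moreover have "(\<lambda>s. Gamma (of_real A + s)) holomorphic_on {s. Re s > - A}"
    by (intro holomorphic_Gamma' holomorphic_on_add holomorphic_on_const holomorphic_on_ident
        Gamma_of_real_add_not_nonpos_Ints) auto
  ultimately show False
    using assms not_is_pole_holomorphic[OF open_halfspace_Re_gt] by blast
qed

lemma is_pole_Gamma_minus_imp:
  fixes D :: real
  assumes "is_pole (\<lambda>s. Gamma (of_real D - s)) (w :: complex)"
  shows "D \<le> Re w"
proof (rule ccontr)
  assume "\<not> D \<le> Re w"
  then have "w \<in> {s. Re s < D}" by simp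
  moreover have "(\<lambda>s. Gamma (of_real D - s)) holomorphic_on {s. Re s < D}"
    by (intro holomorphic_Gamma' holomorphic_on_diff holomorphic_on_const holomorphic_on_ident
        Gamma_of_real_minus_not_nonpos_Ints) auto
  ultimately show False
    using assms not_is_pole_holomorphic[OF open_halfspace_Re_lt] by blast
qed

lemma is_pole_Gamma_at_0: "is_pole Gamma (0 :: complex)"
  using is_pole_Gamma[of 0] by simp

lemma is_pole_Gamma_add: "is_pole (\<lambda>s. Gamma (of_real A + s)) (of_real (- A) :: complex)"
proof -
  have "filterlim (\<lambda>s. of_real A + s) (at (0 :: complex)) (at (of_real (- A)))"
    unfolding filterlim_at
    by (auto simp: eventually_at_filter add_eq_0_iff intro!: tendsto_eq_intros)
  then show ?thesis
    using is_pole_Gamma_at_0 unfolding is_pole_def by (rule filterlim_compose[rotated])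
qed

lemma is_pole_Gamma_minus: "is_pole (\<lambda>s. Gamma (of_real D - s)) (of_real D :: complex)"
proof -
  have "filterlim (\<lambda>s. of_real D - s) (at (0 :: complex)) (at (of_real D))"
    unfolding filterlim_at
    by (auto simp: eventually_at_filter intro!: tendsto_eq_intros)
  then show ?thesis
    using is_pole_Gamma_at_0 unfolding is_pole_def by (rule filterlim_compose[rotated])
qed

lemma meijer_G_integrand_eq_mellin_kernel:
  "meijer_G_integrand 2 1 [of_real (1 - D)] [of_real A, of_real B] x s = mellin_kernel A B D x s"
  by (simp add: meijer_G_integrand_def mellin_kernel_def numeral_2_eq_2 mult.assoc)

text \<open>
  Only the pole nearest to the line matters in each family, that is \<open>-A\<close>, \<open>-B\<close> and \<open>D\<close>.
\<close>

lemma meijer_G_separating_iff: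
  "meijer_G_separating 2 1 [of_real (1 - D)] [of_real A, of_real B] \<kappa> \<longleftrightarrow> - A < \<kappa> \<and> - B < \<kappa> \<and> \<kappa> < D"
proof -
  have 1: "(\<forall>w. is_pole (\<lambda>s. Gamma (of_real C + s)) w \<longrightarrow> Re w < \<kappa>) \<longleftrightarrow> - C < \<kappa>" for C :: real
    using is_pole_Gamma_add_imp[of C] is_pole_Gamma_add[of C] by (fastforce simp del: of_real_minus)
  have 2: "(\<forall>w. is_pole (\<lambda>s. Gamma (of_real D - s)) w \<longrightarrow> \<kappa> < Re w) \<longleftrightarrow> \<kappa> < D"
    using is_pole_Gamma_minus_imp[of D] is_pole_Gamma_minus[of D] by fastforce
  have 3: "1 - of_real (1 - D) - s = (of_real D - s :: complex)" for s by simp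
  show ?thesis
    unfolding meijer_G_separating_def by (simp add: numeral_2_eq_2 less_Suc_eq all_conj_distrib 1 2 3 conj_ac del: of_real_diff)
qed

lemma meijer_G_line_eq:
  assumes "x > 0" "- A < \<kappa>" "- B < \<kappa>" "\<kappa> < D"
  shows "(\<lambda>t. meijer_G_integrand 2 1 [of_real (1 - D)] [of_real A, of_real B] x (Complex \<kappa> t) * \<i>) integrable_on UNIV"
    and "meijer_G_line 2 1 [of_real (1 - D)] [of_real A, of_real B] x \<kappa>
      = (\<integral>t. mellin_kernel A B D x (Complex \<kappa> t) \<partial>lborel) / (2 * of_real pi)"
proof -
  have "integrable lborel (\<lambda>t. mellin_kernel A B D x (Complex \<kappa> t) * \<i>)"
    using integrable_mellin_kernel[OF assms] by (rule integrable_mult_left)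
  then have "((\<lambda>t. mellin_kernel A B D x (Complex \<kappa> t) * \<i>) has_integral
      (\<integral>t. mellin_kernel A B D x (Complex \<kappa> t) * \<i> \<partial>lborel)) UNIV"
    by (rule has_integral_integral_lborel)
  then have hi: "((\<lambda>t. mellin_kernel A B D x (Complex \<kappa> t) * \<i>) has_integral
      (\<integral>t. mellin_kernel A B D x (Complex \<kappa> t) \<partial>lborel) * \<i>) UNIV"
    by simp
  then show "(\<lambda>t. meijer_G_integrand 2 1 [of_real (1 - D)] [of_real A, of_real B] x (Complex \<kappa> t) * \<i>) integrable_on UNIV"
    unfolding meijer_G_integrand_eq_mellin_kernel by (rule has_integral_integrable)
  show "meijer_G_line 2 1 [of_real (1 - D)] [of_real A, of_real B] x \<kappa>
      = (\<integral>t. mellin_kernel A B D x (Complex \<kappa> t) \<partial>lborel) / (2 * of_real pi)"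
    unfolding meijer_G_line_def meijer_G_integrand_eq_mellin_kernel integral_unique[OF hi] by simp
qed

text \<open>
  The substitution \<open>v \<mapsto> u v\<close> pulls the scale \<open>u\<close> out of \<open>(u + v)\<^sup>-\<^sup>q\<close>.
\<close>

lemma half_line_integral_scale:
  fixes p q a u :: real
  assumes "u > 0"
    and int: "integrable lborel (\<lambda>v. indicator {0<..} v * (v powr p * (1 + v) powr (- q) * exp (- (a * u) * v)))"
  shows "has_bochner_integral lborel (\<lambda>v. indicator {0<..} v * (v powr p * (u + v) powr (- q) * exp (- a * v)))
      (u powr (p - q + 1) * (\<integral>v. indicator {0<..} v * (v powr p * (1 + v) powr (- q) * exp (- (a * u) * v)) \<partial>lborel))"
    (is "has_bochner_integral _ ?g (_ * integral\<^sup>L _ ?h)")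
proof -
  have eq: "?g (0 + u * v) = u powr (p - q) * ?h v" for v
  proof (cases "v > 0")
    case True
    have "u + u * v = u * (1 + v)" by (simp add: algebra_simps)
    then have "(u + u * v) powr (- q) = u powr (- q) * (1 + v) powr (- q)"
      using assms True by (simp add: powr_mult)
    moreover have "(u * v) powr p = u powr p * v powr p"
      using assms True by (simp add: powr_mult)
    moreover have "u powr (p - q) = u powr p * u powr (- q)"
      by (simp flip: powr_add)
    ultimately show ?thesis
      using True assms by (simp add: mult_ac)
  next
    case False
    then show ?thesis using assms by (simp add: zero_less_mult_iff)
  qed
  have "has_bochner_integral lborel (\<lambda>v. u powr (p - q) * ?h v) (u powr (p - q) * integral\<^sup>L lborel ?h)"
    using int by (intro has_bochner_integral_mult_right) (simp add: has_bochner_integral_iff)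
  moreover have "u powr (p - q) * integral\<^sup>L lborel ?h = (u powr (p - q + 1) * integral\<^sup>L lborel ?h) /\<^sub>R \<bar>u\<bar>"
  proof -
    have "u powr (p - q + 1) = u * u powr (p - q)"
      using assms by (simp add: powr_add)
    then show ?thesis using assms by simp
  qed
  ultimately show ?thesis
    using assms lborel_has_bochner_integral_real_affine_iff[of u ?g "u powr (p - q + 1) * integral\<^sup>L lborel ?h" 0]
    by (simp only: eq)
qed

lemma has_integral_half_line:
  fixes g :: "real \<Rightarrow> real"
  assumes "has_bochner_integral lborel (\<lambda>v. indicator {0<..} v * g v) I"
  shows "g integrable_on {0<..}" "integral {0<..} g = I"
proof -
  have "set_integrable lborel {0<..} g"
    using assms by (simp add: set_integrable_def has_bochner_integral_iff)
  from set_borel_integral_eq_integral[OF this] show "g integrable_on {0<..}" "integral {0<..} g = I"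
    using assms by (simp_all add: set_lebesgue_integral_def has_bochner_integral_iff)
qed

theorem theorem3p3:
  fixes \<alpha> \<gamma> \<delta> a u :: real
  assumes "\<alpha> > -1" and "\<gamma> > -1" and "\<delta> > 0" and "a > 0" and "u > 0"
  shows
    "(\<exists>\<kappa>. meijer_G_separating 2 1 [of_real (-1 - \<gamma>)] [of_real \<alpha>, of_real (\<delta> - 1)] \<kappa>) \<and>
     (\<forall>\<kappa>. meijer_G_separating 2 1 [of_real (-1 - \<gamma>)] [of_real \<alpha>, of_real (\<delta> - 1)] \<kappa> \<longrightarrow>
        (\<lambda>t. meijer_G_integrand 2 1 [of_real (-1 - \<gamma>)] [of_real \<alpha>, of_real (\<delta> - 1)]
               (a * u) (Complex \<kappa> t) * \<i>) integrable_on UNIV \<and>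
        meijer_G_line 2 1 [of_real (-1 - \<gamma>)] [of_real \<alpha>, of_real (\<delta> - 1)] (a * u) \<kappa> =
        meijer_G 2 1 [of_real (-1 - \<gamma>)] [of_real \<alpha>, of_real (\<delta> - 1)] (a * u)) \<and>
     (\<lambda>v. v powr (\<alpha> + \<gamma> + 1) * (u + v) powr (- (\<gamma> + 1 + \<delta>)) * exp (- a * v))
        integrable_on {0<..} \<and>
     (\<lambda>v. v powr (\<alpha> + \<gamma> + 1) * (1 + v) powr (- (\<gamma> + 1 + \<delta>)) * exp (- a * u * v))
        integrable_on {0<..} \<and>
     meijer_G 2 1 [of_real (-1 - \<gamma>)] [of_real \<alpha>, of_real (\<delta> - 1)] (a * u) =
       of_real (Gamma (\<gamma> + 1 + \<delta>) * a powr \<alpha> * u powr (\<delta> - 1) *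
         integral {0<..}
           (\<lambda>v. v powr (\<alpha> + \<gamma> + 1) * (u + v) powr (- (\<gamma> + 1 + \<delta>)) * exp (- a * v))) \<and>
     meijer_G 2 1 [of_real (-1 - \<gamma>)] [of_real \<alpha>, of_real (\<delta> - 1)] (a * u) =
       of_real (Gamma (\<gamma> + 1 + \<delta>) * a powr \<alpha> * u powr \<alpha> *
         integral {0<..}
           (\<lambda>v. v powr (\<alpha> + \<gamma> + 1) * (1 + v) powr (- (\<gamma> + 1 + \<delta>)) * exp (- a * u * v))) \<and>
     ((\<forall>\<nu>::nat. \<delta> - 1 - \<alpha> \<noteq> real \<nu> \<and> \<delta> - 1 - \<alpha> \<noteq> - real \<nu>) \<longrightarrow>
       meijer_G 2 1 [of_real (-1 - \<gamma>)] [of_real \<alpha>, of_real (\<delta> - 1)] (a * u) =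
       of_real (
         Gamma (\<delta> - 1 - \<alpha>) * Gamma (2 + \<gamma> + \<alpha>) * (a * u) powr \<alpha> *
           hyp1F1 (2 + \<gamma> + \<alpha>) (2 + \<alpha> - \<delta>) (a * u) +
         Gamma (1 + \<gamma> + \<delta>) * Gamma (1 + \<alpha> - \<delta>) * (a * u) powr (\<delta> - 1) *
           hyp1F1 (1 + \<gamma> + \<delta>) (\<delta> - \<alpha>) (a * u)))"
proof -
  define B D q where "B = \<delta> - 1" and "D = 2 + \<gamma>" and "q = \<gamma> + 1 + \<delta>"
  define x where "x = a * u"
  have x: "x > 0" using assms by (simp add: x_def)
  let ?as = "[of_real (- 1 - \<gamma>)] :: complex list" and ?bs = "[of_real \<alpha>, of_real (\<delta> - 1)] :: complex list"
  have lists: "?as = [of_real (1 - D)]" "?bs = [of_real \<alpha>, of_real B]"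
    by (simp_all add: B_def D_def)
  define h where "h = (\<lambda>v. v powr (\<alpha> + \<gamma> + 1) * (1 + v) powr (- q) * exp (- x * v))"
  define R where "R = Gamma q * x powr \<alpha> * (\<integral>v. indicator {0<..} v * h v \<partial>lborel)"
  have sep: "meijer_G_separating 2 1 ?as ?bs \<kappa> \<longleftrightarrow> - \<alpha> < \<kappa> \<and> - B < \<kappa> \<and> \<kappa> < D" for \<kappa>
    unfolding lists by (rule meijer_G_separating_iff)
  \<comment> \<open>The line through 1 separates the poles for all admissible parameters.\<close>
  have one: "- \<alpha> < 1 \<and> - B < 1 \<and> 1 < D"
    using assms by (simp add: B_def D_def)
  have params: "\<alpha> + D - 1 = \<alpha> + \<gamma> + 1" "B + D = q"
    by (simp_all add: B_def D_def q_def)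
  have h_int: "integrable lborel (\<lambda>v. indicator {0<..} v * h v)"
    using mellin_kernel_line_integral(1)[of x \<alpha> 1 B D] x one unfolding params h_def by blast
  have line: "(\<integral>t. mellin_kernel \<alpha> B D x (Complex \<kappa> t) \<partial>lborel) = 2 * of_real pi * of_real R"
    if "- \<alpha> < \<kappa> \<and> - B < \<kappa> \<and> \<kappa> < D" for \<kappa>
    using mellin_kernel_line_integral(2)[of x \<alpha> \<kappa> B D] x that unfolding params h_def R_def by blast
  have G_line: "meijer_G_line 2 1 ?as ?bs x \<kappa> = of_real R" if "meijer_G_separating 2 1 ?as ?bs \<kappa>" for \<kappa>
  proof -
    have c: "- \<alpha> < \<kappa>" "- B < \<kappa>" "\<kappa> < D" using that unfolding sep by blast+
    then have "(\<integral>t. mellin_kernel \<alpha> B D x (Complex \<kappa> t) \<partial>lborel) = 2 * of_real pi * of_real R"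
      by (intro line) simp
    then show ?thesis unfolding lists meijer_G_line_eq(2)[OF x c] by simp
  qed
  have ex: "\<exists>\<kappa>. meijer_G_separating 2 1 ?as ?bs \<kappa>"
    unfolding sep using one by blast
  have G: "meijer_G 2 1 ?as ?bs x = of_real R"
    unfolding meijer_G_def by (rule G_line[OF someI_ex[OF ex]])
  have integ: "(\<lambda>t. meijer_G_integrand 2 1 ?as ?bs x (Complex \<kappa> t) * \<i>) integrable_on UNIV"
    if "meijer_G_separating 2 1 ?as ?bs \<kappa>" for \<kappa>
  proof -
    have c: "- \<alpha> < \<kappa>" "- B < \<kappa>" "\<kappa> < D" using that unfolding sep by blast+
    show ?thesis unfolding lists by (rule meijer_G_line_eq(1)[OF x c])
  qed
  have h_eq: "h = (\<lambda>v. v powr (\<alpha> + \<gamma> + 1) * (1 + v) powr (- (\<gamma> + 1 + \<delta>)) * exp (- a * u * v))"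
    by (simp add: h_def x_def q_def)
  define H where "H = (\<integral>v. indicator {0<..} v * h v \<partial>lborel)"
  have "has_bochner_integral lborel (\<lambda>v. indicator {0<..} v * h v) H"
    using h_int by (simp add: has_bochner_integral_iff H_def)
  note second = has_integral_half_line[OF this, unfolded h_eq]
  have "has_bochner_integral lborel
      (\<lambda>v. indicator {0<..} v * (v powr (\<alpha> + \<gamma> + 1) * (u + v) powr (- q) * exp (- a * v)))
      (u powr (\<alpha> + \<gamma> + 1 - q + 1) * H)"
    unfolding H_def h_def x_def
    by (rule half_line_integral_scale[OF \<open>u > 0\<close>]) (use h_int in \<open>simp add: h_def x_def\<close>)
  note first = has_integral_half_line[OF this, unfolded q_def]
  have R1: "R = Gamma (\<gamma> + 1 + \<delta>) * a powr \<alpha> * u powr \<alpha> * H"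
    using assms by (simp add: R_def H_def q_def x_def powr_mult)
  have R2: "R = Gamma (\<gamma> + 1 + \<delta>) * a powr \<alpha> * u powr (\<delta> - 1) * (u powr (\<alpha> + \<gamma> + 1 - (\<gamma> + 1 + \<delta>) + 1) * H)"
  proof -
    have "u powr \<alpha> = u powr (\<delta> - 1) * u powr (\<alpha> + \<gamma> + 1 - (\<gamma> + 1 + \<delta>) + 1)"
      by (simp flip: powr_add)
    then show ?thesis unfolding R1 by (simp only: mult.assoc)
  qed
  have R3: "R = Gamma (\<delta> - 1 - \<alpha>) * Gamma (2 + \<gamma> + \<alpha>) * x powr \<alpha> *
           hyp1F1 (2 + \<gamma> + \<alpha>) (2 + \<alpha> - \<delta>) x +
         Gamma (1 + \<gamma> + \<delta>) * Gamma (1 + \<alpha> - \<delta>) * x powr (\<delta> - 1) *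
           hyp1F1 (1 + \<gamma> + \<delta>) (\<delta> - \<alpha>) x" (is "_ = ?S")
    if "\<forall>\<nu>::nat. \<delta> - 1 - \<alpha> \<noteq> real \<nu> \<and> \<delta> - 1 - \<alpha> \<noteq> - real \<nu>"
  proof -
    have "\<alpha> - B \<notin> \<int>"
    proof
      assume "\<alpha> - B \<in> \<int>"
      then obtain k where k: "\<alpha> - B = of_int k" by (auto elim: Ints_cases)
      show False
      proof (cases "k \<ge> 0")
        case True
        then have "\<delta> - 1 - \<alpha> = - real (nat k)" using k by (simp add: B_def)
        with that show False by blast
      next
        case False
        then have "\<delta> - 1 - \<alpha> = real (nat (- k))" using k by (simp add: B_def)
        with that show False by blast
      qed
    qed
    then have "(\<integral>t. mellin_kernel \<alpha> B D x (Complex 1 t) \<partial>lborel) = 2 * of_real pi * of_real (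
        Gamma (B - \<alpha>) * Gamma (\<alpha> + D) * x powr \<alpha> * hyp1F1 (\<alpha> + D) (1 + \<alpha> - B) x +
        Gamma (\<alpha> - B) * Gamma (B + D) * x powr B * hyp1F1 (B + D) (1 + B - \<alpha>) x)"
      using one x by (intro mellin_barnes_residue_series) auto
    also have "B - \<alpha> = \<delta> - 1 - \<alpha>" by (simp add: B_def)
    also have "\<alpha> + D = 2 + \<gamma> + \<alpha>" by (simp add: D_def)
    also have "1 + \<alpha> - B = 2 + \<alpha> - \<delta>" by (simp add: B_def)
    also have "\<alpha> - B = 1 + \<alpha> - \<delta>" by (simp add: B_def)
    also have "B + D = 1 + \<gamma> + \<delta>" by (simp add: B_def D_def)
    also have "1 + B - \<alpha> = \<delta> - \<alpha>" by (simp add: B_def)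
    finally have "of_real R = complex_of_real (Gamma (\<delta> - 1 - \<alpha>) * Gamma (2 + \<gamma> + \<alpha>) * x powr \<alpha> *
           hyp1F1 (2 + \<gamma> + \<alpha>) (2 + \<alpha> - \<delta>) x +
         Gamma (1 + \<alpha> - \<delta>) * Gamma (1 + \<gamma> + \<delta>) * x powr B *
           hyp1F1 (1 + \<gamma> + \<delta>) (\<delta> - \<alpha>) x)"
      using line[OF one] by simp
    then show ?thesis unfolding of_real_eq_iff by (simp add: B_def mult_ac)
  qed
  show ?thesis
    unfolding x_def[symmetric]
    apply (intro conjI allI impI)
    subgoal by (rule ex)
    subgoal by (rule integ)
    subgoal by (simp only: G_line G)
    subgoal by (rule first(1))
    subgoal by (rule second(1))
    subgoal unfolding G first(2) of_real_eq_iff by (rule R2)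
    subgoal unfolding G second(2) of_real_eq_iff by (rule R1)
    subgoal unfolding G of_real_eq_iff by (rule R3)
    done
qed

end
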